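(* Every eigenvalue of the boundary value problem (P) is analytically simple, i.e. has analytic multiplicity one: if $\mu$ is an eigenvalue of (P), then $\mu$ is a zero of order exactly one of the entire function $w(\lambda)$.
   Context: Data. Let $-1<h_1<h_2<h_3<1$ and $I=[-1,h_1)\cup(h_1,h_2)\cup(h_2,h_3)\cup(h_3,1]$. Let $p_1,p_2,p_3,p_4$ be nonzero real constants, and let $p(x)=p_1^2$ on $[-1,h_1)$, $p(x)=p_2^2$ on $(h_1,h_2)$, $p(x)=p_3^2$ on $(h_2,h_3)$, $p(x)=p_4^2$ on $(h_3,1]$. Let $q\in L^1(I,\mathbb{R})$, and let $\alpha_i,\beta_i$ ($i=1,\dots,8$), $\beta_1',\beta_2'$ be real numbers (primes on $\beta_1',\beta_2'$ are part of the name). Assume throughout $$\theta=\alpha_3\beta_4-\beta_3\alpha_4>0,\quad \gamma=\alpha_5\beta_6-\beta_5\alpha_6>0,\quad \xi=\alpha_7\beta_8-\beta_7\alpha_8>0,\quad \rho=\beta_1'\beta_2-\beta_1\beta_2'>0,\quad |\alpha_1|+|\alpha_2|\neq 0.$$ Problem (P), with eigenparameter $\lambda\in\mathbb{C}$: the equation $-(p u')'+qu=\lambda u$ on $I$; the boundary condition $\alpha_1u(-1)+\alpha_2u'(-1)=0$; the eigenparameter-dependent boundary condition $\lambda[\beta_1'u(1)-\beta_2'u'(1)]+[\beta_1u(1)-\beta_2u'(1)]=0$; and the transmission conditions (T) $u(h_1+0)=\alpha_3u(h_1-0)+\beta_3u'(h_1-0)$, $u'(h_1+0)=\alpha_4u(h_1-0)+\beta_4u'(h_1-0)$,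 $u(h_2+0)=\alpha_5u(h_2-0)+\beta_5u'(h_2-0)$, $u'(h_2+0)=\alpha_6u(h_2-0)+\beta_6u'(h_2-0)$, $u(h_3+0)=\alpha_7u(h_3-0)+\beta_7u'(h_3-0)$, $u'(h_3+0)=\alpha_8u(h_3-0)+\beta_8u'(h_3-0)$, where $\pm0$ denotes one-sided limits. Solutions are understood with $u,u'$ absolutely continuous on each of the four subintervals. $\lambda$ is an eigenvalue of (P) if a nontrivial solution $u$ (an eigenfunction) exists. Characteristic function. For $\lambda\in\mathbb{C}$ let $\phi(\cdot,\lambda)$ be the unique solution of $-(pu')'+qu=\lambda u$ on $I$ satisfying $\phi(-1,\lambda)=\alpha_2$, $\phi'(-1,\lambda)=-\alpha_1$ and (T), and let $\chi(\cdot,\lambda)$ be the unique solution of the same equation on $I$ satisfying $\chi(1,\lambda)=\lambda\beta_2'+\beta_2$, $\chi'(1,\lambda)=\lambda\beta_1'+\beta_1$ and (T). Let $\varphi_1,\chi_1$ be the restrictions of $\phi,\chi$ to $[-1,h_1)$. The Wronskian $w(\lambda)=\varphi_1(x,\lambda)\chi_1'(x,\lambda)-\varphi_1'(x,\lambda)\chi_1(x,\lambda)$ is independent of $x\in[-1,h_1)$ and is an entire function of $\lambda$; the eigenvalues of (P) coincide with the zeros of $w$. The analytic multiplicity of an eigenvalue $\lambda$ of (P) is its order as a root of the characteristic equation $w(\lambda)=0$. *)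

theory Defs
  imports "HOL-Complex_Analysis.Complex_Analysis"
begin

text \<open>
  The eigenparameter is \<open>\<nu>\<close> and the solution normalised at the right endpoint, usually
  called chi, is \<open>\<psi>\<close>, since the symbols for lambda and chi are binders.
  Indexed data are functions on \<^typ>\<open>nat\<close>: \<open>h 1, h 2, h 3\<close> are the interior points,
  \<open>p 1, \<dots>, p 4\<close> the constants whose squares are the leading coefficient,
  \<open>\<alpha> 1, \<dots>, \<alpha> 8\<close> and \<open>\<beta> 1, \<dots>, \<beta> 8\<close> the coefficients of the boundary and transmission
  conditions, and \<open>\<beta>' 1, \<beta>' 2\<close> the two primed constants. Values at all other indices are
  never used. Functions on the four-piece domain are total functions on \<^typ>\<open>real\<close> whose
  values off the domain are never used.
\<close>

text \<open>Absolute continuity on an interval \<open>S\<close>; a pair \<open>(a, b)\<close> stands for the interval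
  from \<open>a\<close> to \<open>b\<close>.\<close>

definition abs_continuous_on :: "real set \<Rightarrow> (real \<Rightarrow> 'a::real_normed_vector) \<Rightarrow> bool" where
  "abs_continuous_on S f \<longleftrightarrow>
     (\<forall>\<epsilon>>0. \<exists>\<delta>>0. \<forall>D :: (real \<times> real) set.
        finite D \<and>
        (\<forall>(a, b)\<in>D. a < b \<and> {a..b} \<subseteq> S) \<and>
        pairwise (\<lambda>(a, b) (c, d). {a<..<b} \<inter> {c<..<d} = {}) D \<and>
        (\<Sum>(a, b)\<in>D. b - a) < \<delta>
        \<longrightarrow> (\<Sum>(a, b)\<in>D. norm (f b - f a)) < \<epsilon>)"

definition subintervals :: "(nat \<Rightarrow> real) \<Rightarrow> real set set" where
  "subintervals h = {{-1..<h 1}, {h 1<..<h 2}, {h 2<..<h 3}, {h 3<..1}}"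

definition dom_I :: "(nat \<Rightarrow> real) \<Rightarrow> real set" where
  "dom_I h = \<Union> (subintervals h)"

definition coeff_p :: "(nat \<Rightarrow> real) \<Rightarrow> (nat \<Rightarrow> real) \<Rightarrow> real \<Rightarrow> real" where
  "coeff_p h p x =
     (if x < h 1 then (p 1)\<^sup>2
      else if x < h 2 then (p 2)\<^sup>2
      else if x < h 3 then (p 3)\<^sup>2
      else (p 4)\<^sup>2)"

text \<open>The derivative \<open>u'\<close> on the domain; at \<open>-1\<close> and \<open>1\<close> it is the one-sided derivative.\<close>

definition D_I :: "(nat \<Rightarrow> real) \<Rightarrow> (real \<Rightarrow> complex) \<Rightarrow> real \<Rightarrow> complex" where
  "D_I h u x = vector_derivative u (at x within dom_I h)"

definition solves_equation ::
  "(nat \<Rightarrow> real) \<Rightarrow> (nat \<Rightarrow> real) \<Rightarrow> (real \<Rightarrow> real) \<Rightarrow> complex \<Rightarrow> (real \<Rightarrow> complex) \<Rightarrow> bool" where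
  "solves_equation h p q \<nu> u \<longleftrightarrow>
     u differentiable_on dom_I h \<and>
     (\<forall>J\<in>subintervals h. abs_continuous_on J u \<and> abs_continuous_on J (D_I h u)) \<and>
     (AE x in lebesgue. x \<in> dom_I h \<longrightarrow>
        (\<exists>d. ((\<lambda>t. coeff_p h p t *\<^sub>R D_I h u t) has_vector_derivative d) (at x within dom_I h) \<and>
             - d + q x *\<^sub>R u x = \<nu> * u x))"

text \<open>At \<open>h j\<close>, the numbers \<open>ul, dl\<close> are the limits from the left of \<open>u\<close> and \<open>u'\<close>. The two rows
  have indices \<open>3, 4\<close> at \<open>h 1\<close>, then \<open>5, 6\<close> at \<open>h 2\<close>, then \<open>7, 8\<close> at \<open>h 3\<close>.\<close>

definition transmission ::
  "(nat \<Rightarrow> real) \<Rightarrow> (nat \<Rightarrow> real) \<Rightarrow> (nat \<Rightarrow> real) \<Rightarrow> (real \<Rightarrow> complex) \<Rightarrow> bool" where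
  "transmission h \<alpha> \<beta> u \<longleftrightarrow>
     (\<forall>j\<in>{1, 2, 3}. \<exists>ul dl.
        (u \<longlongrightarrow> ul) (at_left (h j)) \<and>
        (D_I h u \<longlongrightarrow> dl) (at_left (h j)) \<and>
        (u \<longlongrightarrow> \<alpha> (2*j + 1) *\<^sub>R ul + \<beta> (2*j + 1) *\<^sub>R dl) (at_right (h j)) \<and>
        (D_I h u \<longlongrightarrow> \<alpha> (2*j + 2) *\<^sub>R ul + \<beta> (2*j + 2) *\<^sub>R dl) (at_right (h j)))"

definition solves_problem ::
  "(nat \<Rightarrow> real) \<Rightarrow> (nat \<Rightarrow> real) \<Rightarrow> (real \<Rightarrow> real) \<Rightarrow> (nat \<Rightarrow> real) \<Rightarrow> (nat \<Rightarrow> real) \<Rightarrow> (nat \<Rightarrow> real)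
     \<Rightarrow> complex \<Rightarrow> (real \<Rightarrow> complex) \<Rightarrow> bool" where
  "solves_problem h p q \<alpha> \<beta> \<beta>' \<nu> u \<longleftrightarrow>
     solves_equation h p q \<nu> u \<and>
     \<alpha> 1 *\<^sub>R u (-1) + \<alpha> 2 *\<^sub>R D_I h u (-1) = 0 \<and>
     \<nu> * (\<beta>' 1 *\<^sub>R u 1 - \<beta>' 2 *\<^sub>R D_I h u 1) + (\<beta> 1 *\<^sub>R u 1 - \<beta> 2 *\<^sub>R D_I h u 1) = 0 \<and>
     transmission h \<alpha> \<beta> u"

definition is_eigenvalue ::
  "(nat \<Rightarrow> real) \<Rightarrow> (nat \<Rightarrow> real) \<Rightarrow> (real \<Rightarrow> real) \<Rightarrow> (nat \<Rightarrow> real) \<Rightarrow> (nat \<Rightarrow> real) \<Rightarrow> (nat \<Rightarrow> real)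
     \<Rightarrow> complex \<Rightarrow> bool" where
  "is_eigenvalue h p q \<alpha> \<beta> \<beta>' \<nu> \<longleftrightarrow>
     (\<exists>u. solves_problem h p q \<alpha> \<beta> \<beta>' \<nu> u \<and> (\<exists>x\<in>dom_I h. u x \<noteq> 0))"

text \<open>The defining properties of \<open>\<phi>(\<cdot>,\<nu>)\<close> and \<open>\<psi>(\<cdot>,\<nu>)\<close>, which determine them uniquely on the
  domain.\<close>

definition is_phi ::
  "(nat \<Rightarrow> real) \<Rightarrow> (nat \<Rightarrow> real) \<Rightarrow> (real \<Rightarrow> real) \<Rightarrow> (nat \<Rightarrow> real) \<Rightarrow> (nat \<Rightarrow> real)
     \<Rightarrow> complex \<Rightarrow> (real \<Rightarrow> complex) \<Rightarrow> bool" where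
  "is_phi h p q \<alpha> \<beta> \<nu> u \<longleftrightarrow>
     solves_equation h p q \<nu> u \<and> transmission h \<alpha> \<beta> u \<and>
     u (-1) = of_real (\<alpha> 2) \<and> D_I h u (-1) = - of_real (\<alpha> 1)"

definition is_chi ::
  "(nat \<Rightarrow> real) \<Rightarrow> (nat \<Rightarrow> real) \<Rightarrow> (real \<Rightarrow> real) \<Rightarrow> (nat \<Rightarrow> real) \<Rightarrow> (nat \<Rightarrow> real) \<Rightarrow> (nat \<Rightarrow> real)
     \<Rightarrow> complex \<Rightarrow> (real \<Rightarrow> complex) \<Rightarrow> bool" where
  "is_chi h p q \<alpha> \<beta> \<beta>' \<nu> u \<longleftrightarrow>
     solves_equation h p q \<nu> u \<and> transmission h \<alpha> \<beta> u \<and>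
     u 1 = \<nu> * of_real (\<beta>' 2) + of_real (\<beta> 2) \<and>
     D_I h u 1 = \<nu> * of_real (\<beta>' 1) + of_real (\<beta> 1)"

definition wronskian ::
  "(nat \<Rightarrow> real) \<Rightarrow> (real \<Rightarrow> complex) \<Rightarrow> (real \<Rightarrow> complex) \<Rightarrow> real \<Rightarrow> complex" where
  "wronskian h u v x = u x * D_I h v x - D_I h u x * v x"

end

theory Submission
  imports Defs
begin

text \<open>
  Everything rests on one identity. Let \<open>u\<close> and \<open>v\<close> solve the differential equation for the parameters
  \<open>\<nu>\<close> and \<open>\<mu>\<close> and satisfy the transmission conditions. On each piece \<open>p W(u, v)\<close>, with the Wronskian
  \<open>W(u, v) = u v' - u' v\<close>, has derivative \<open>(\<nu> - \<mu>) u v\<close> almost everywhere. At an interior point the Wronskian is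
  multiplied by the determinant of the transmission matrix. These determinants are positive, so
  positive weights on the pieces make the weighted Wronskian continuous, and summing over the pieces
  gives \<open>W(u, v)(1) - c W(u, v)(-1) = (\<nu> - \<mu>) \<langle>u, v\<rangle>\<close> with a constant \<open>c > 0\<close> and a weighted bilinear
  pairing \<open>\<langle>u, v\<rangle>\<close> (\<open>lagrange_identity_pieces\<close>).

  For \<open>u = \<phi>(\<cdot>,\<nu>)\<close> and \<open>v = \<psi>(\<cdot>,\<mu>)\<close> the Wronskian at \<open>-1\<close> is \<open>w(\<mu>)\<close>, because the initial data of \<open>\<phi>\<close> do
  not depend on the parameter. The one at \<open>1\<close> differs from \<open>c w(\<nu>)\<close> by \<open>(\<nu> - \<mu>) R(\<nu>)\<close>, where
  \<open>R(\<nu>) = \<beta>'\<^sub>1 \<phi>(1,\<nu>) - \<beta>'\<^sub>2 \<phi>'(1,\<nu>)\<close>, because the data of \<open>\<psi>\<close> at \<open>1\<close> are affine in the parameter. Hence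
  \<open>c (w(\<nu>) - w(\<mu>)) = (\<nu> - \<mu>) (\<langle>\<phi>(\<cdot>,\<nu>), \<psi>(\<cdot>,\<mu>)\<rangle> + R(\<nu>))\<close> (\<open>w_difference\<close>). A Gronwall estimate shows that
  \<open>\<phi>(\<cdot>,\<nu>)\<close> tends to \<open>\<phi>(\<cdot>,\<mu>)\<close> uniformly as \<open>\<nu>\<close> tends to \<open>\<mu>\<close>. So \<open>w\<close> is differentiable everywhere, and
  \<open>c w'(\<mu>) = \<langle>\<phi>, \<psi>\<rangle> + R\<close> at \<open>\<mu>\<close> (\<open>w_derivative\<close>).

  Let \<open>\<mu>\<close> be an eigenvalue. Then \<open>\<phi>\<close> satisfies the boundary condition at \<open>1\<close>, so \<open>w(\<mu>) = 0\<close> and \<open>\<psi> = k \<phi>\<close>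
  for some \<open>k\<close>. Evaluating \<open>\<beta>'\<^sub>1 \<psi> - \<beta>'\<^sub>2 \<psi>'\<close> at \<open>1\<close> gives \<open>k R = \<rho>\<close>, so \<open>R \<noteq> 0\<close>. The identity for \<open>\<phi>\<close> and its
  complex conjugate, with the boundary condition at \<open>1\<close>, shows that \<open>\<mu>\<close> is real: this is the
  self-adjointness of the problem. Hence \<open>\<phi>\<close> and
  \<open>R\<close> are real, and \<open>R c w'(\<mu>) = \<rho> \<langle>\<phi>, \<phi>\<rangle> + R\<^sup>2 > 0\<close>. So the zero is simple.

  The main analytic input is the fundamental theorem of calculus for absolutely continuous functions whose
  derivative is given almost everywhere, proved with the Henstock-Kurzweil integral.
\<close>

section \<open>Absolutely continuous functions\<close>

lemma abs_continuous_on_subset: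
  assumes "abs_continuous_on S f" "T \<subseteq> S"
  shows "abs_continuous_on T f"
  unfolding abs_continuous_on_def
proof (intro allI impI)
  fix \<epsilon> :: real assume "\<epsilon> > 0"
  then obtain \<delta> where "\<delta> > 0" and d: "\<And>D :: (real \<times> real) set. finite D \<and>
        (\<forall>(a, b)\<in>D. a < b \<and> {a..b} \<subseteq> S) \<and>
        pairwise (\<lambda>(a, b) (c, d). {a<..<b} \<inter> {c<..<d} = {}) D \<and>
        (\<Sum>(a, b)\<in>D. b - a) < \<delta> \<Longrightarrow> (\<Sum>(a, b)\<in>D. norm (f b - f a)) < \<epsilon>"
    using assms(1) unfolding abs_continuous_on_def by meson
  show "\<exists>\<delta>>0. \<forall>D :: (real \<times> real) set. finite D \<and>
        (\<forall>(a, b)\<in>D. a < b \<and> {a..b} \<subseteq> T) \<and>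
        pairwise (\<lambda>(a, b) (c, d). {a<..<b} \<inter> {c<..<d} = {}) D \<and>
        (\<Sum>(a, b)\<in>D. b - a) < \<delta> \<longrightarrow> (\<Sum>(a, b)\<in>D. norm (f b - f a)) < \<epsilon>"
  proof (intro exI[of _ \<delta>] conjI allI impI, fact)
    fix D :: "(real \<times> real) set"
    assume D: "finite D \<and> (\<forall>(a, b)\<in>D. a < b \<and> {a..b} \<subseteq> T) \<and>
        pairwise (\<lambda>(a, b) (c, d). {a<..<b} \<inter> {c<..<d} = {}) D \<and> (\<Sum>(a, b)\<in>D. b - a) < \<delta>"
    then have "\<forall>(a, b)\<in>D. a < b \<and> {a..b} \<subseteq> S" using assms(2) by fast
    then show "(\<Sum>(a, b)\<in>D. norm (f b - f a)) < \<epsilon>" using D by (intro d) simp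
  qed
qed

lemma abs_continuous_on_imp_continuous_on:
  fixes S :: "real set"
  assumes f: "abs_continuous_on S f" and S: "is_interval S"
  shows "continuous_on S f"
  unfolding continuous_on_iff
proof (intro ballI allI impI)
  fix x \<epsilon> :: real assume x: "x \<in> S" and "\<epsilon> > 0"
  then obtain \<delta> where "\<delta> > 0" and d: "\<And>D :: (real \<times> real) set. finite D \<and>
        (\<forall>(a, b)\<in>D. a < b \<and> {a..b} \<subseteq> S) \<and>
        pairwise (\<lambda>(a, b) (c, d). {a<..<b} \<inter> {c<..<d} = {}) D \<and>
        (\<Sum>(a, b)\<in>D. b - a) < \<delta> \<Longrightarrow> (\<Sum>(a, b)\<in>D. norm (f b - f a)) < \<epsilon>"
    using f unfolding abs_continuous_on_def by meson
  have *: "norm (f b - f a) < \<epsilon>" if "a < b" "a \<in> S" "b \<in> S" "b - a < \<delta>" for a b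
  proof -
    have "{a..b} \<subseteq> S" using S that unfolding is_interval_1 by (meson atLeastAtMost_iff subsetI)
    then show ?thesis using d[of "{(a, b)}"] that by simp
  qed
  have "dist (f y) (f x) < \<epsilon>" if "y \<in> S" "dist y x < \<delta>" for y
  proof (cases y x rule: linorder_cases)
    case less
    then show ?thesis using *[of y x] that x by (auto simp: dist_norm norm_minus_commute)
  next
    case greater
    then show ?thesis using *[of x y] that x by (auto simp: dist_norm)
  qed (use \<open>\<epsilon> > 0\<close> in simp)
  then show "\<exists>d>0. \<forall>y\<in>S. dist y x < d \<longrightarrow> dist (f y) (f x) < \<epsilon>"
    using \<open>\<delta> > 0\<close> by blast
qed

text \<open>
  Differences, products of bounded functions and linear images are absolutely continuous by the same
  domination argument, which is made once here.
\<close>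
lemma abs_continuous_on_combine:
  fixes f :: "real \<Rightarrow> 'a::real_normed_vector" and g :: "real \<Rightarrow> 'b::real_normed_vector"
    and k :: "real \<Rightarrow> 'c::real_normed_vector"
  assumes f: "abs_continuous_on S f" and g: "abs_continuous_on S g"
    and le: "\<And>a b. \<lbrakk>a \<in> S; b \<in> S\<rbrakk> \<Longrightarrow> norm (k b - k a) \<le> B * norm (f b - f a) + B * norm (g b - g a)"
  shows "abs_continuous_on S k"
  unfolding abs_continuous_on_def
proof (intro allI impI)
  fix \<epsilon> :: real assume "\<epsilon> > 0"
  define C where "C = \<bar>B\<bar> + 1"
  have "C > 0" "B \<le> C" by (auto simp: C_def)
  define \<eta> where "\<eta> = \<epsilon> / (2 * C)"
  have "\<eta> > 0" using \<open>\<epsilon> > 0\<close> \<open>C > 0\<close> by (simp add: \<eta>_def)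
  obtain \<delta>1 where "\<delta>1 > 0" and d1: "\<And>D :: (real \<times> real) set. finite D \<and>
        (\<forall>(a, b)\<in>D. a < b \<and> {a..b} \<subseteq> S) \<and>
        pairwise (\<lambda>(a, b) (c, d). {a<..<b} \<inter> {c<..<d} = {}) D \<and>
        (\<Sum>(a, b)\<in>D. b - a) < \<delta>1 \<Longrightarrow> (\<Sum>(a, b)\<in>D. norm (f b - f a)) < \<eta>"
    using f \<open>\<eta> > 0\<close> unfolding abs_continuous_on_def by meson
  obtain \<delta>2 where "\<delta>2 > 0" and d2: "\<And>D :: (real \<times> real) set. finite D \<and>
        (\<forall>(a, b)\<in>D. a < b \<and> {a..b} \<subseteq> S) \<and>
        pairwise (\<lambda>(a, b) (c, d). {a<..<b} \<inter> {c<..<d} = {}) D \<and>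
        (\<Sum>(a, b)\<in>D. b - a) < \<delta>2 \<Longrightarrow> (\<Sum>(a, b)\<in>D. norm (g b - g a)) < \<eta>"
    using g \<open>\<eta> > 0\<close> unfolding abs_continuous_on_def by meson
  show "\<exists>\<delta>>0. \<forall>D :: (real \<times> real) set. finite D \<and>
        (\<forall>(a, b)\<in>D. a < b \<and> {a..b} \<subseteq> S) \<and>
        pairwise (\<lambda>(a, b) (c, d). {a<..<b} \<inter> {c<..<d} = {}) D \<and>
        (\<Sum>(a, b)\<in>D. b - a) < \<delta> \<longrightarrow> (\<Sum>(a, b)\<in>D. norm (k b - k a)) < \<epsilon>"
  proof (intro exI[of _ "min \<delta>1 \<delta>2"] conjI allI impI)
    show "min \<delta>1 \<delta>2 > 0" using \<open>\<delta>1 > 0\<close> \<open>\<delta>2 > 0\<close> by simp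
    fix D :: "(real \<times> real) set"
    assume D: "finite D \<and> (\<forall>(a, b)\<in>D. a < b \<and> {a..b} \<subseteq> S) \<and>
        pairwise (\<lambda>(a, b) (c, d). {a<..<b} \<inter> {c<..<d} = {}) D \<and>
        (\<Sum>(a, b)\<in>D. b - a) < min \<delta>1 \<delta>2"
    have "(\<Sum>(a, b)\<in>D. norm (k b - k a))
        \<le> (\<Sum>(a, b)\<in>D. C * norm (f b - f a) + C * norm (g b - g a))"
    proof (rule sum_mono, clarify)
      fix a b assume "(a, b) \<in> D"
      then have "a < b" "{a..b} \<subseteq> S" using D by auto
      then have "a \<in> S" "b \<in> S" by auto
      from le[OF this] show "norm (k b - k a) \<le> C * norm (f b - f a) + C * norm (g b - g a)"
        using \<open>B \<le> C\<close> mult_right_mono[OF \<open>B \<le> C\<close> norm_ge_zero, of "f b - f a"]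
          mult_right_mono[OF \<open>B \<le> C\<close> norm_ge_zero, of "g b - g a"] by linarith
    qed
    also have "\<dots> = C * (\<Sum>(a, b)\<in>D. norm (f b - f a)) + C * (\<Sum>(a, b)\<in>D. norm (g b - g a))"
      by (simp add: sum.distrib sum_distrib_left case_prod_beta)
    also have "\<dots> < C * \<eta> + C * \<eta>"
      using d1[of D] d2[of D] D \<open>C > 0\<close> by (intro add_strict_mono mult_strict_left_mono) auto
    also have "\<dots> = \<epsilon>" using \<open>C > 0\<close> by (simp add: \<eta>_def field_simps)
    finally show "(\<Sum>(a, b)\<in>D. norm (k b - k a)) < \<epsilon>" .
  qed
qed

lemma abs_continuous_on_diff:
  assumes "abs_continuous_on S f" "abs_continuous_on S g"
  shows "abs_continuous_on S (\<lambda>x. f x - g x)"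
proof (rule abs_continuous_on_combine[OF assms, where B = 1])
  fix a b
  show "norm (f b - g b - (f a - g a)) \<le> 1 * norm (f b - f a) + 1 * norm (g b - g a)"
    using norm_triangle_ineq4[of "f b - f a" "g b - g a"] by (simp add: algebra_simps)
qed

lemma abs_continuous_on_mult:
  fixes f g :: "real \<Rightarrow> 'a::real_normed_algebra"
  assumes "abs_continuous_on S f" "abs_continuous_on S g"
    and f: "\<And>x. x \<in> S \<Longrightarrow> norm (f x) \<le> B" and g: "\<And>x. x \<in> S \<Longrightarrow> norm (g x) \<le> B"
  shows "abs_continuous_on S (\<lambda>x. f x * g x)"
proof (rule abs_continuous_on_combine[OF assms(1,2), where B = B])
  fix a b assume ab: "a \<in> S" "b \<in> S"
  have "f b * g b - f a * g a = (f b - f a) * g b + f a * (g b - g a)" by (simp add: algebra_simps)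
  also have "norm \<dots> \<le> norm (f b - f a) * norm (g b) + norm (f a) * norm (g b - g a)"
    by (meson add_mono norm_mult_ineq norm_triangle_le)
  also have "\<dots> \<le> norm (f b - f a) * B + B * norm (g b - g a)"
    using f[OF ab(1)] g[OF ab(2)] order_trans[OF norm_ge_zero f[OF ab(1)]]
    by (intro add_mono mult_mono) auto
  finally show "norm (f b * g b - f a * g a) \<le> B * norm (f b - f a) + B * norm (g b - g a)"
    by (simp add: mult.commute)
qed

lemma abs_continuous_on_cong:
  assumes "\<And>x. x \<in> S \<Longrightarrow> f x = g x" "abs_continuous_on S f"
  shows "abs_continuous_on S g"
  using abs_continuous_on_combine[OF assms(2,2), of g 1] assms(1) by simp

lemma abs_continuous_on_bounded_linear:
  assumes L: "bounded_linear L" and f: "abs_continuous_on S f"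
  shows "abs_continuous_on S (\<lambda>x. L (f x))"
proof -
  obtain B where B: "B > 0" "\<And>x. norm (L x) \<le> norm x * B" using bounded_linear.pos_bounded[OF L] by blast
  show ?thesis
  proof (rule abs_continuous_on_combine[OF f f, where B = B])
    fix a b
    have "norm (L (f b) - L (f a)) \<le> norm (f b - f a) * B"
      using B(2)[of "f b - f a"] bounded_linear.linear[OF L] by (simp add: linear_diff)
    moreover have "0 \<le> B * norm (f b - f a)" using B by simp
    ultimately show "norm (L (f b) - L (f a)) \<le> B * norm (f b - f a) + B * norm (f b - f a)"
      by (simp add: mult.commute)
  qed
qed

lemma sum_length_disjoint_intervals_le:
  fixes D :: "(real \<times> real) set"
  assumes "finite D" and D: "\<forall>(a, b)\<in>D. a < b \<and> {a<..<b} \<subseteq> T"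
    and disj: "pairwise (\<lambda>(a, b) (c, d). {a<..<b} \<inter> {c<..<d} = {}) D"
    and T: "T \<in> lmeasurable"
  shows "(\<Sum>(a, b)\<in>D. b - a) \<le> measure lebesgue T"
proof -
  define A where "A = (\<lambda>(a, b). {a<..<b::real})"
  have "(\<Sum>(a, b)\<in>D. b - a) = (\<Sum>d\<in>D. measure lebesgue (A d))"
    using D by (intro sum.cong) (auto simp: A_def)
  also have "\<dots> = measure lebesgue (\<Union>d\<in>D. A d)"
  proof (rule measure_finite_Union[symmetric])
    show "disjoint_family_on A D"
      unfolding disjoint_family_on_def
    proof (intro ballI impI)
      fix d e assume "d \<in> D" "e \<in> D" "d \<noteq> e"
      from pairwiseD[OF disj this] show "A d \<inter> A e = {}" by (auto simp: A_def split: prod.splits)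
    qed
    show "emeasure lebesgue (A d) \<noteq> \<infinity>" if "d \<in> D" for d
      using D that by (auto simp: A_def)
  qed (use assms(1) in \<open>auto simp: A_def\<close>)
  also have "\<dots> \<le> measure lebesgue T"
    using D T by (intro measure_mono_fmeasurable) (auto simp: A_def assms(1))
  finally show ?thesis .
qed

text \<open>
  The gauge is chosen differently on and off the exceptional set \<open>N\<close>. At a tag off \<open>N\<close> it comes from
  differentiability, and those intervals contribute an error proportional to their length. At a
  tag in \<open>N\<close> it keeps the interval inside an open set of small measure containing \<open>N\<close>. The intervals with
  such tags thus have small total length, and by absolute continuity \<open>f\<close> varies little over them.
\<close>
theorem fundamental_theorem_of_calculus_abs_continuous:
  fixes f g :: "real \<Rightarrow> 'a::banach"
  assumes "a \<le> b" and f: "abs_continuous_on {a..b} f" and N: "negligible N"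
    and g: "\<And>x. x \<in> {a..b} - N \<Longrightarrow> (f has_vector_derivative g x) (at x within {a..b})"
  shows "(g has_integral (f b - f a)) {a..b}"
proof -
  \<comment> \<open>The values of \<open>g\<close> on \<open>N\<close> are arbitrary and do not affect the integral; with \<open>0\<close> there,
    the intervals tagged in \<open>N\<close> contribute only increments of \<open>f\<close>.\<close>
  define g0 where "g0 x = (if x \<in> N then 0 else g x)" for x
  have "(g0 has_integral (f b - f a)) {a..b}"
    unfolding has_integral_real
  proof (intro allI impI)
    fix e :: real assume "e > 0"
    define \<eta> where "\<eta> = e / (2 * (b - a + 1))"
    have "\<eta> > 0" using \<open>e > 0\<close> \<open>a \<le> b\<close> by (simp add: \<eta>_def)
    have "\<eta> * (b - a) < e / 2"
      using \<open>e > 0\<close> \<open>a \<le> b\<close> by (simp add: \<eta>_def field_simps)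
    have "e / 2 > 0" using \<open>e > 0\<close> by simp
    then obtain \<delta> where "\<delta> > 0" and \<delta>: "\<And>D :: (real \<times> real) set. finite D \<and>
        (\<forall>(c, d)\<in>D. c < d \<and> {c..d} \<subseteq> {a..b}) \<and>
        pairwise (\<lambda>(a, b) (c, d). {a<..<b} \<inter> {c<..<d} = {}) D \<and>
        (\<Sum>(a, b)\<in>D. b - a) < \<delta> \<Longrightarrow> (\<Sum>(a, b)\<in>D. norm (f b - f a)) < e / 2"
      using f unfolding abs_continuous_on_def by meson
    have N0: "N \<in> null_sets lebesgue" using N negligible_iff_null_sets by blast
    then have NL: "N \<in> sets lebesgue" by blast
    obtain T where T: "open T" "N \<subseteq> T" "T - N \<in> lmeasurable" "emeasure lebesgue (T - N) < ennreal \<delta>"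
      using sets_lebesgue_outer_open[OF NL \<open>\<delta> > 0\<close>] by metis
    have TL: "T \<in> sets lebesgue" using T(1) by auto
    have emT: "emeasure lebesgue T = emeasure lebesgue (T - N)"
      using emeasure_Diff_null_set[OF N0 TL] by simp
    then have Tm: "T \<in> lmeasurable" using T(4) TL by (intro fmeasurableI) (auto simp: top.extremum_strict order_less_trans)
    have mT: "measure lebesgue T < \<delta>"
      using T(4) emT Tm by (metis emeasure_eq_measure2 ennreal_less_iff measure_nonneg)
    have "\<exists>d>0. (x \<in> N \<longrightarrow> ball x d \<subseteq> T) \<and> (x \<in> {a..b} - N \<longrightarrow>
         (\<forall>y\<in>{a..b}. norm (y-x) < d \<longrightarrow> norm (f y - f x - (y-x) *\<^sub>R g x) \<le> \<eta> * norm (y-x)))" for x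
    proof (cases "x \<in> N")
      case True
      then show ?thesis using T(1,2) by (auto simp: open_contains_ball)
    next
      case False
      show ?thesis
      proof (cases "x \<in> {a..b}")
        case True
        then show ?thesis using g[of x] False \<open>\<eta> > 0\<close>
          unfolding has_vector_derivative_def has_derivative_within_alt by simp
      qed (use False in \<open>auto intro: exI[of _ 1]\<close>)
    qed
    then obtain d where d: "\<And>x. 0 < d x" "\<And>x. x \<in> N \<Longrightarrow> ball x (d x) \<subseteq> T"
      "\<And>x y. \<lbrakk>x \<in> {a..b}; x \<notin> N; y \<in> {a..b}; norm (y-x) < d x\<rbrakk>
         \<Longrightarrow> norm (f y - f x - (y-x) *\<^sub>R g x) \<le> \<eta> * norm (y-x)" by (metis DiffI)
    show "\<exists>\<gamma>. gauge \<gamma> \<and> (\<forall>\<D>. \<D> tagged_division_of {a..b} \<and> \<gamma> fine \<D> \<longrightarrow>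
        norm ((\<Sum>(x,k)\<in>\<D>. measure lborel k *\<^sub>R g0 x) - (f b - f a)) < e)"
    proof (intro exI[of _ "\<lambda>x. ball x (d x)"] conjI allI impI, goal_cases)
      case 1 then show ?case using d(1) gauge_ball_dependent by blast
    next
      case (2 p)
      then have p: "p tagged_division_of {a..b}" and fine: "(\<lambda>x. ball x (d x)) fine p" by auto
      have finp: "finite p" using p by blast
      have K: "\<exists>u v. K = {u..v} \<and> u \<le> v \<and> Inf K = u \<and> Sup K = v \<and> a \<le> u \<and> v \<le> b
          \<and> u \<le> x \<and> x \<le> v \<and> measure lborel K = v - u \<and> {u..v} \<subseteq> ball x (d x)" if xK: "(x, K) \<in> p" for x K
      proof -
        obtain u v where "K = cbox u v" using tagged_division_ofD(4)[OF p xK] by blast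
        then have k: "K = {u..v}" by simp
        have "x \<in> K" "K \<subseteq> {a..b}" using tagged_division_ofD(2,3)[OF p xK] by auto
        moreover have "K \<subseteq> ball x (d x)" using fine xK by blast
        ultimately have "u \<le> x" "x \<le> v" "{u..v} \<subseteq> ball x (d x)" "{u..v} \<subseteq> {a..b}" using k by auto
        then have "u \<le> v" "a \<le> u" "v \<le> b" by auto
        then show ?thesis
          using k \<open>u \<le> x\<close> \<open>x \<le> v\<close> \<open>{u..v} \<subseteq> ball x (d x)\<close>
          by (intro exI[of _ u] exI[of _ v] conjI) simp_all
      qed
      have intK: "interior K = {Inf K<..<Sup K}" if xK: "(x, K) \<in> p" for x K
      proof -
        obtain u v where "K = {u..v}" "Inf K = u" "Sup K = v" using K[OF xK] by metis
        then show ?thesis by (simp add: interior_atLeastAtMost_real)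
      qed
      define p1 where "p1 = {(x, K) \<in> p. x \<notin> N}"
      \<comment> \<open>Degenerate intervals contribute nothing, and absolute continuity speaks of proper ones only.\<close>
      define p2 where "p2 = {(x, K) \<in> p. x \<in> N \<and> Inf K < Sup K}"
      define term' where "term' = (\<lambda>(x, K). measure lborel K *\<^sub>R g0 x - (f (Sup K) - f (Inf K)))"
      have fin12: "finite p1" "finite p2" using finp by (auto simp: p1_def p2_def intro: finite_subset)
      have "(\<Sum>(x,k)\<in>p. measure lborel k *\<^sub>R g0 x) - (f b - f a) = sum term' p"
        unfolding additive_tagged_division_1[OF \<open>a \<le> b\<close> p, of f, symmetric] term'_def
        by (simp add: sum_subtractf case_prod_beta)
      also have "\<dots> = sum term' (p1 \<union> p2)"
      proof (rule sum.mono_neutral_right[OF finp])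
        show "\<forall>i\<in>p - (p1 \<union> p2). term' i = 0"
        proof
          fix y assume y: "y \<in> p - (p1 \<union> p2)"
          obtain x K where "y = (x, K)" by (cases y)
          with y K[of x K] show "term' y = 0"
            by (auto simp: p1_def p2_def term'_def g0_def)
        qed
      qed (auto simp: p1_def p2_def)
      also have "\<dots> = sum term' p1 + sum term' p2"
        using fin12 by (intro sum.union_disjoint) (auto simp: p1_def p2_def)
      also have "norm \<dots> \<le> norm (sum term' p1) + norm (sum term' p2)" by (rule norm_triangle_ineq)
      also have "\<dots> < e / 2 + e / 2"
      proof (rule add_strict_mono)
        have "norm (sum term' p1) \<le> (\<Sum>(x, K)\<in>p1. \<eta> * (Sup K - Inf K))"
        proof (rule sum_norm_le, clarify)
          fix x K assume xK: "(x, K) \<in> p1"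
          then have "(x, K) \<in> p" "x \<notin> N" by (auto simp: p1_def)
          from K[OF this(1)] obtain u v where uv: "K = {u..v}" "Inf K = u" "Sup K = v" "u \<le> x" "x \<le> v"
            "a \<le> u" "v \<le> b" "measure lborel K = v - u" "{u..v} \<subseteq> ball x (d x)" by metis
          have "norm (u - x) < d x" "norm (v - x) < d x"
            using uv(4,5) subsetD[OF uv(9), of u] subsetD[OF uv(9), of v] by (auto simp: dist_norm)
          then have le: "norm (f v - f x - (v-x) *\<^sub>R g x) \<le> \<eta> * (v - x)"
            "norm (f u - f x - (u-x) *\<^sub>R g x) \<le> \<eta> * (x - u)"
            using d(3)[of x v] d(3)[of x u] uv \<open>x \<notin> N\<close> by auto
          have "term' (x, K) = (f u - f x - (u-x) *\<^sub>R g x) - (f v - f x - (v-x) *\<^sub>R g x)"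
            unfolding term'_def using uv \<open>x \<notin> N\<close> by (simp add: g0_def algebra_simps)
          also have "norm \<dots> \<le> \<eta> * (x - u) + \<eta> * (v - x)"
            using norm_triangle_ineq4 le by (metis (no_types, lifting) add_mono order_trans)
          finally show "norm (term' (x, K)) \<le> \<eta> * (Sup K - Inf K)"
            using uv by (simp add: algebra_simps)
        qed
        also have "\<dots> \<le> (\<Sum>(x, K)\<in>p. \<eta> * (Sup K - Inf K))"
        proof (rule sum_mono2[OF finp])
          fix y assume "y \<in> p - p1"
          then show "0 \<le> (case y of (x, K) \<Rightarrow> \<eta> * (Sup K - Inf K))"
            using K[of "fst y" "snd y"] \<open>\<eta> > 0\<close> by (cases y) auto
        qed (auto simp: p1_def)
        also have "\<dots> = \<eta> * (b - a)"
          unfolding additive_tagged_division_1[OF \<open>a \<le> b\<close> p, of "\<lambda>x. x", symmetric]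
          by (simp add: sum_distrib_left case_prod_beta)
        also have "\<dots> < e / 2" by fact
        finally show "norm (sum term' p1) < e / 2" .
      next
        define r where "r = (\<lambda>(x::real, K::real set). (Inf K, Sup K))"
        have r_disj: "{Inf K<..<Sup K} \<inter> {Inf K'<..<Sup K'} = {}"
          if "(x, K) \<in> p2" "(x', K') \<in> p2" "(x, K) \<noteq> (x', K')" for x K x' K'
        proof -
          have "interior K \<inter> interior K' = {}"
            using tagged_division_ofD(5)[OF p, of x K x' K'] that by (auto simp: p2_def)
          moreover have "interior K = {Inf K<..<Sup K}" "interior K' = {Inf K'<..<Sup K'}"
            using that intK[of x K] intK[of x' K'] by (auto simp: p2_def)
          ultimately show ?thesis by simp
        qed
        have r_lt: "Inf K < Sup K" if "(x, K) \<in> p2" for x K using that by (auto simp: p2_def)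
        have inj: "inj_on r p2"
        proof (rule inj_onI, clarify)
          fix x K x' K' assume A: "(x, K) \<in> p2" "(x', K') \<in> p2" "r (x, K) = r (x', K')"
          show "x = x' \<and> K = K'"
          proof (rule ccontr)
            assume "\<not> (x = x' \<and> K = K')"
            then have "{Inf K<..<Sup K} \<inter> {Inf K'<..<Sup K'} = {}" using r_disj A by blast
            then show False using A r_lt[OF A(1)] by (auto simp: r_def)
          qed
        qed
        have "norm (sum term' p2) \<le> (\<Sum>(x, K)\<in>p2. norm (f (Sup K) - f (Inf K)))"
        proof (rule sum_norm_le, clarify)
          fix x K assume "(x, K) \<in> p2"
          then show "norm (term' (x, K)) \<le> norm (f (Sup K) - f (Inf K))"
            by (auto simp: p2_def term'_def g0_def norm_minus_commute)
        qed
        also have "\<dots> = (\<Sum>(u, v)\<in>r ` p2. norm (f v - f u))"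
          by (subst sum.reindex[OF inj]) (simp add: r_def case_prod_beta)
        also have "\<dots> < e / 2"
        proof (rule \<delta>, intro conjI)
          show "finite (r ` p2)" using fin12 by simp
          show "\<forall>(c, d)\<in>r ` p2. c < d \<and> {c..d} \<subseteq> {a..b}"
          proof clarify
            fix c e x K assume "(x, K) \<in> p2" "(c, e) = r (x, K)"
            then have "c < e" "a \<le> c" "e \<le> b" using K[of x K] by (auto simp: r_def p2_def)
            then show "c < e \<and> {c..e} \<subseteq> {a..b}" by auto
          qed
          show pw: "pairwise (\<lambda>(a, b) (c, d). {a<..<b} \<inter> {c<..<d} = {}) (r ` p2)"
          proof (rule pairwiseI)
            fix i j assume "i \<in> r ` p2" "j \<in> r ` p2" "i \<noteq> j"
            then obtain x K x' K' where A: "(x, K) \<in> p2" "(x', K') \<in> p2" "i = r (x, K)" "j = r (x', K')"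
              by auto
            then have "(x, K) \<noteq> (x', K')" using \<open>i \<noteq> j\<close> by auto
            from r_disj[OF A(1,2) this] show "(\<lambda>(a, b) (c, d). {a<..<b} \<inter> {c<..<d} = {}) i j"
              by (simp add: A r_def)
          qed
          have "(\<Sum>(c, d)\<in>r ` p2. d - c) \<le> measure lebesgue T"
          proof (rule sum_length_disjoint_intervals_le[OF _ _ pw Tm])
            show "\<forall>(c, e)\<in>r ` p2. c < e \<and> {c<..<e} \<subseteq> T"
            proof clarify
              fix c e x K assume A: "(x, K) \<in> p2" "(c, e) = r (x, K)"
              then have "ball x (d x) \<subseteq> T" using d(2) by (auto simp: p2_def)
              moreover have "{c..e} \<subseteq> ball x (d x)" using A K[of x K] by (auto simp: r_def p2_def)
              ultimately show "c < e \<and> {c<..<e} \<subseteq> T"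
                using A greaterThanLessThan_subseteq_atLeastAtMost_iff[of c e c e] by (auto simp: r_def p2_def)
            qed
          qed (use fin12 in simp)
          then show "(\<Sum>(c, d)\<in>r ` p2. d - c) < \<delta>" using mT by linarith
        qed
        finally show "norm (sum term' p2) < e / 2" .
      qed
      finally show ?case by simp
    qed
  qed
  then show ?thesis
    by (rule has_integral_spike[OF N, rotated]) (simp add: g0_def)
qed

text \<open>
  Absolute continuity is given only inside \<open>(a, b)\<close>, as it is for the equation on its subintervals.
  The endpoints are reached by continuity, as \<open>f\<close> minus the integral of \<open>g\<close> is constant inside.
\<close>
lemma abs_continuous_eq_integral:
  fixes f g :: "real \<Rightarrow> 'a::banach"
  assumes "a < b" and cont: "continuous_on {a..b} f" and ac: "abs_continuous_on {a<..<b} f"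
    and N: "negligible N"
    and deriv: "\<And>x. x \<in> {a<..<b} - N \<Longrightarrow> (f has_vector_derivative g x) (at x)"
    and g: "g integrable_on {a..b}" and x: "x \<in> {a..b}"
  shows "f x = f a + integral {a..x} g"
proof -
  define F where "F t = f t - integral {a..t} g" for t
  define m where "m = (a + b) / 2"
  have m: "m \<in> {a<..<b}" using \<open>a < b\<close> by (auto simp: m_def)
  have cF: "continuous_on {a..b} F"
    unfolding F_def by (intro continuous_intros cont indefinite_integral_continuous_1 g)
  have *: "F c = F d" if cd: "c \<le> d" "c \<in> {a<..<b}" "d \<in> {a<..<b}" for c d
  proof -
    have sub: "{c..d} \<subseteq> {a<..<b}" using cd by auto
    have "(g has_integral (f d - f c)) {c..d}"
    proof (rule fundamental_theorem_of_calculus_abs_continuous[OF cd(1) _ N])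
      show "abs_continuous_on {c..d} f" using abs_continuous_on_subset[OF ac sub] .
      show "(f has_vector_derivative g x) (at x within {c..d})" if "x \<in> {c..d} - N" for x
        using deriv[of x] that subsetD[OF sub, of x] has_vector_derivative_at_within by blast
    qed
    moreover have "integral {a..c} g + integral {c..d} g = integral {a..d} g"
      using cd by (intro Henstock_Kurzweil_Integration.integral_combine integrable_on_subinterval[OF g]) auto
    ultimately show ?thesis by (simp add: F_def integral_unique algebra_simps)
  qed
  have const: "F t = F m" if "t \<in> {a<..<b}" for t
    using *[OF _ that m] *[OF _ m that] by (metis linear)
  have cl: "closure {a<..<b} = {a..b}" using \<open>a < b\<close> by simp
  have "F t = F m" if "t \<in> {a..b}" for t
    by (rule continuous_constant_on_closure[of "{a<..<b}"]) (use cF cl const that in auto)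
  then have "F x = F a" using x \<open>a < b\<close> by simp
  then show ?thesis by (simp add: F_def algebra_simps)
qed

section \<open>A Gronwall bound with an integrable coefficient\<close>

text \<open>
  Let \<open>Z\<close> be the right-hand side of the integral inequality. It is nondecreasing and dominates \<open>z\<close>, so
  \<open>Z x \<le> Z s + Z x / 2\<close> when \<open>m\<close> integrates to at most \<open>1 / 2\<close> over \<open>[s, x]\<close>. Thus \<open>Z\<close> at most doubles
  over each such stretch, and \<open>n\<close> counts the stretches. The usual exponential bound would need the chain rule
  for the integral of a function that is merely integrable.
\<close>
lemma gronwall_bound:
  fixes z m :: "real \<Rightarrow> real"
  assumes cont: "continuous_on {a..b} z" and z0: "\<And>x. x \<in> {a..b} \<Longrightarrow> 0 \<le> z x"
    and m: "m integrable_on {a..b}" and m0: "\<And>x. x \<in> {a..b} \<Longrightarrow> 0 \<le> m x"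
    and mz: "(\<lambda>x. m x * z x) integrable_on {a..b}"
    and le: "\<And>x. x \<in> {a..b} \<Longrightarrow> z x \<le> A + integral {a..x} (\<lambda>t. m t * z t)"
    and "0 \<le> A" and x: "x \<in> {a..b}" and n: "integral {a..x} m \<le> real n / 2"
  shows "z x \<le> 2 ^ n * A"
proof -
  define Z where "Z x = A + integral {a..x} (\<lambda>t. m t * z t)" for x
  have mz_sub: "(\<lambda>x. m x * z x) integrable_on {c..d}" if "{c..d} \<subseteq> {a..b}" for c d
    using integrable_on_subinterval[OF mz] that by auto
  have m_sub: "m integrable_on {c..d}" if "{c..d} \<subseteq> {a..b}" for c d
    using integrable_on_subinterval[OF m] that by auto
  have zZ: "z x \<le> Z x" if "x \<in> {a..b}" for x using le[OF that] by (simp add: Z_def)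
  have Z_split: "Z d = Z c + integral {c..d} (\<lambda>t. m t * z t)" if "c \<le> d" "c \<in> {a..b}" "d \<in> {a..b}" for c d
    using Henstock_Kurzweil_Integration.integral_combine[of a c d "\<lambda>t. m t * z t"] that mz_sub[of a d]
    by (simp add: Z_def)
  have mono: "Z c \<le> Z d" if "c \<le> d" "c \<in> {a..b}" "d \<in> {a..b}" for c d
    unfolding Z_split[OF that] using that m0 z0 mz_sub[of c d]
    by (auto intro!: Henstock_Kurzweil_Integration.integral_nonneg)
  have "Z x \<le> 2 ^ n * A" if "x \<in> {a..b}" "integral {a..x} m \<le> real n / 2" for n x
    using that
  proof (induction n arbitrary: x)
    case 0
    have "integral {a..x} (\<lambda>t. m t * z t) \<le> integral {a..x} (\<lambda>t. Z x * m t)"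
    proof (rule integral_le)
      fix t assume t: "t \<in> {a..x}"
      then have "z t \<le> Z x" using zZ[of t] mono[of t x] 0 by auto
      moreover have "0 \<le> m t" using m0[of t] t 0 by auto
      ultimately show "m t * z t \<le> Z x * m t" by (metis mult.commute mult_left_mono)
    qed (use 0 in \<open>auto intro!: mz_sub integrable_on_mult_right m_sub\<close>)
    also have "\<dots> = Z x * integral {a..x} m" by simp
    also have "integral {a..x} m = 0"
      using 0 m0 m_sub[of a x] Henstock_Kurzweil_Integration.integral_nonneg[of m "{a..x}"] by (intro antisym) auto
    finally show ?case by (simp add: Z_def)
  next
    case (Suc n)
    show ?case
    proof (cases "integral {a..x} m \<le> real n / 2")
      case True
      have "Z x \<le> 2 ^ n * A" using Suc.IH[OF Suc.prems(1) True] .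
      also have "\<dots> \<le> 2 ^ Suc n * A" using \<open>0 \<le> A\<close> by (intro mult_right_mono power_increasing) auto
      finally show ?thesis .
    next
      case False
      have "\<exists>s\<ge>a. s \<le> x \<and> integral {a..s} m = real n / 2"
        using Suc.prems(1) False m_sub[of a x]
        by (intro IVT' indefinite_integral_continuous_1) auto
      then obtain s where s: "a \<le> s" "s \<le> x" "integral {a..s} m = real n / 2" by blast
      have sub: "{s..x} \<subseteq> {a..b}" using s Suc.prems by auto
      have half: "integral {s..x} m \<le> 1 / 2"
        using Henstock_Kurzweil_Integration.integral_combine[of a s x m] s Suc.prems m_sub[of a x] by (simp add: field_simps)
      have "integral {s..x} (\<lambda>t. m t * z t) \<le> integral {s..x} (\<lambda>t. Z x * m t)"
      proof (rule integral_le)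
        fix t assume t: "t \<in> {s..x}"
        then have "z t \<le> Z x" using zZ[of t] mono[of t x] s Suc.prems by auto
        moreover have "0 \<le> m t" using m0[of t] t sub by auto
        ultimately show "m t * z t \<le> Z x * m t" by (metis mult.commute mult_left_mono)
      qed (use sub in \<open>auto intro!: mz_sub integrable_on_mult_right m_sub\<close>)
      also have "\<dots> = Z x * integral {s..x} m" by simp
      also have "\<dots> \<le> Z x * (1 / 2)"
        using half zZ[OF Suc.prems(1)] z0[OF Suc.prems(1)] by (intro mult_left_mono) auto
      finally have "Z x \<le> 2 * Z s" using Z_split[of s x] s Suc.prems by auto
      also have "Z s \<le> 2 ^ n * A" using Suc.IH[of s] s Suc.prems by auto
      finally show ?thesis by simp
    qed
  qed
  from this[OF x n] zZ[OF x] show ?thesis by linarith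
qed

section \<open>The Sturm-Liouville equation on one interval\<close>

text \<open>
  The equation \<open>-(P u')' + q u = \<nu> u\<close> with constant \<open>P\<close>, as a first-order system for \<open>U = u\<close> and \<open>V = u'\<close>
  that have been extended continuously to the closed interval.
\<close>
definition sl_solution ::
  "real \<Rightarrow> real \<Rightarrow> real \<Rightarrow> (real \<Rightarrow> real) \<Rightarrow> complex \<Rightarrow> (real \<Rightarrow> complex) \<Rightarrow> (real \<Rightarrow> complex) \<Rightarrow> bool" where
  "sl_solution a b P q \<nu> U V \<longleftrightarrow>
     continuous_on {a..b} U \<and> continuous_on {a..b} V \<and>
     abs_continuous_on {a<..<b} U \<and> abs_continuous_on {a<..<b} V \<and>
     (\<forall>x\<in>{a<..<b}. (U has_vector_derivative V x) (at x)) \<and>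
     (\<exists>N. negligible N \<and> (\<forall>x\<in>{a<..<b} - N.
        (V has_vector_derivative (of_real (q x) - \<nu>) * U x / of_real P) (at x)))"

lemma bounded_on_interval:
  fixes f :: "real \<Rightarrow> 'a::real_normed_vector"
  assumes "continuous_on {a..b} f"
  obtains B where "B \<ge> 0" "\<And>x. x \<in> {a..b} \<Longrightarrow> norm (f x) \<le> B"
proof -
  have "bounded (f ` {a..b})" using assms by (intro compact_imp_bounded compact_continuous_image) auto
  then obtain B where "\<And>x. x \<in> {a..b} \<Longrightarrow> norm (f x) \<le> B" unfolding bounded_iff by (meson imageI)
  then have "norm (f x) \<le> \<bar>B\<bar>" if "x \<in> {a..b}" for x
    using that by (meson abs_ge_self order_trans)
  then show ?thesis using that[OF abs_ge_zero] by blast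
qed

text \<open>
  The terms with \<open>q\<close> cancel in the derivative of the Wronskian \<open>U Y - V X\<close>, which leaves
  \<open>(\<nu> - \<mu>) U X / P\<close> almost everywhere. This is a continuous function, although \<open>V\<close> and \<open>Y\<close> need not
  be differentiable everywhere.
\<close>
lemma lagrange_identity:
  assumes "a < b" and U: "sl_solution a b P q \<nu> U V" and X: "sl_solution a b P q \<mu> X Y"
    and x: "x \<in> {a..b}" and P: "P > 0"
  shows "P * (U x * Y x - V x * X x) - P * (U a * Y a - V a * X a)
    = (\<nu> - \<mu>) * integral {a..x} (\<lambda>t. U t * X t)"
proof -
  have cont: "continuous_on {a..b} U" "continuous_on {a..b} V" "continuous_on {a..b} X" "continuous_on {a..b} Y"
    and ac: "abs_continuous_on {a<..<b} U" "abs_continuous_on {a<..<b} V"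
      "abs_continuous_on {a<..<b} X" "abs_continuous_on {a<..<b} Y"
    and d: "\<And>x. x \<in> {a<..<b} \<Longrightarrow> (U has_vector_derivative V x) (at x)"
      "\<And>x. x \<in> {a<..<b} \<Longrightarrow> (X has_vector_derivative Y x) (at x)"
    using U X by (auto simp: sl_solution_def)
  obtain N1 where N1: "negligible N1" "\<And>x. x \<in> {a<..<b} - N1 \<Longrightarrow>
        (V has_vector_derivative (of_real (q x) - \<nu>) * U x / of_real P) (at x)"
    using U by (auto simp: sl_solution_def)
  obtain N2 where N2: "negligible N2" "\<And>x. x \<in> {a<..<b} - N2 \<Longrightarrow>
        (Y has_vector_derivative (of_real (q x) - \<mu>) * X x / of_real P) (at x)"
    using X by (auto simp: sl_solution_def)
  obtain B1 where B1: "\<And>x. x \<in> {a..b} \<Longrightarrow> norm (U x) \<le> B1" using bounded_on_interval[OF cont(1)] by blast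
  obtain B2 where B2: "\<And>x. x \<in> {a..b} \<Longrightarrow> norm (V x) \<le> B2" using bounded_on_interval[OF cont(2)] by blast
  obtain B3 where B3: "\<And>x. x \<in> {a..b} \<Longrightarrow> norm (X x) \<le> B3" using bounded_on_interval[OF cont(3)] by blast
  obtain B4 where B4: "\<And>x. x \<in> {a..b} \<Longrightarrow> norm (Y x) \<le> B4" using bounded_on_interval[OF cont(4)] by blast
  define B where "B = max (max B1 B2) (max B3 B4)"
  have B: "norm (U x) \<le> B" "norm (V x) \<le> B" "norm (X x) \<le> B" "norm (Y x) \<le> B" if "x \<in> {a<..<b}" for x
    using B1[of x] B2[of x] B3[of x] B4[of x] that by (auto simp: B_def)
  define W where "W t = U t * Y t - V t * X t" for t
  define c where "c = (\<nu> - \<mu>) / of_real P"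
  have "W x = W a + integral {a..x} (\<lambda>t. c * (U t * X t))"
  proof (rule abs_continuous_eq_integral[OF \<open>a < b\<close> _ _ _ _ _ x])
    show "continuous_on {a..b} W" unfolding W_def by (intro continuous_intros cont)
    show "abs_continuous_on {a<..<b} W"
      unfolding W_def by (intro abs_continuous_on_diff abs_continuous_on_mult[where B = B] ac B)
    show "negligible (N1 \<union> N2)" using N1 N2 by simp
    show "(W has_vector_derivative c * (U t * X t)) (at t)" if "t \<in> {a<..<b} - (N1 \<union> N2)" for t
      unfolding W_def
      by (rule derivative_eq_intros N1 N2 d refl | use that P in \<open>simp add: c_def field_simps; fail\<close>)+
    show "(\<lambda>t. c * (U t * X t)) integrable_on {a..b}"
      by (intro integrable_continuous_interval continuous_intros cont)
  qed
  then have "W x - W a = c * integral {a..x} (\<lambda>t. U t * X t)" by simp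
  then have "P * W x - P * W a = P * (c * integral {a..x} (\<lambda>t. U t * X t))"
    by (simp add: algebra_simps flip: right_diff_distrib)
  also have "\<dots> = (\<nu> - \<mu>) * integral {a..x} (\<lambda>t. U t * X t)" using P by (simp add: c_def)
  finally show ?thesis by (simp add: W_def)
qed

lemma absolutely_integrable_scaleR_continuous:
  fixes f :: "real \<Rightarrow> 'a::euclidean_space" and q :: "real \<Rightarrow> real"
  assumes q: "q absolutely_integrable_on {a..b}" and f: "continuous_on {a..b} f"
  shows "(\<lambda>t. q t *\<^sub>R f t) absolutely_integrable_on {a..b}"
proof (rule absolutely_integrable_bounded_measurable_product[where h = "\<lambda>u r. r *\<^sub>R u"])
  show "bilinear (\<lambda>(u::'a) r. r *\<^sub>R u)"
    using bounded_bilinear.flip[OF bounded_bilinear_scaleR] by (simp add: bilinear_conv_bounded_bilinear)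
  show "bounded (f ` {a..b})" using f by (intro compact_imp_bounded compact_continuous_image) auto
qed (use q f in \<open>auto intro: continuous_imp_measurable_on_sets_lebesgue\<close>)

lemma sl_solution_integral_form:
  assumes "a < b" and U: "sl_solution a b P q \<nu> U V" 
    and q: "q absolutely_integrable_on {a..b}" 
  shows "(\<lambda>t. (of_real (q t) - \<nu>) * U t / of_real P) integrable_on {a..b}" (is ?int)
    and "x \<in> {a..b} \<Longrightarrow> U x = U a + integral {a..x} V"
    and "x \<in> {a..b} \<Longrightarrow> V x = V a + integral {a..x} (\<lambda>t. (of_real (q t) - \<nu>) * U t / of_real P)"
proof -
  have cont: "continuous_on {a..b} U" "continuous_on {a..b} V"
    and ac: "abs_continuous_on {a<..<b} U" "abs_continuous_on {a<..<b} V"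
    and d: "\<And>x. x \<in> {a<..<b} \<Longrightarrow> (U has_vector_derivative V x) (at x)"
    using U by (auto simp: sl_solution_def)
  obtain N where N: "negligible N" "\<And>x. x \<in> {a<..<b} - N \<Longrightarrow>
        (V has_vector_derivative (of_real (q x) - \<nu>) * U x / of_real P) (at x)"
    using U by (auto simp: sl_solution_def)
  have "(\<lambda>t. q t *\<^sub>R U t) absolutely_integrable_on {a..b}"
    by (rule absolutely_integrable_scaleR_continuous[OF q cont(1)])
  then have qU: "(\<lambda>t. of_real (q t) * U t) integrable_on {a..b}"
    by (simp add: scaleR_conv_of_real set_lebesgue_integral_eq_integral(1))
  have "(\<lambda>t. (of_real (q t) * U t - \<nu> * U t) / of_real P) integrable_on {a..b}"
    by (intro integrable_on_divide integrable_diff qU integrable_continuous_interval continuous_intros cont)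
  then show int: ?int by (simp add: algebra_simps)
  show "U x = U a + integral {a..x} V" if "x \<in> {a..b}"
    by (rule abs_continuous_eq_integral[OF \<open>a < b\<close> cont(1) ac(1) negligible_empty])
       (use d that cont in \<open>auto intro: integrable_continuous_interval\<close>)
  show "V x = V a + integral {a..x} (\<lambda>t. (of_real (q t) - \<nu>) * U t / of_real P)" if "x \<in> {a..b}"
    by (rule abs_continuous_eq_integral[OF \<open>a < b\<close> cont(2) ac(2) N int that])
qed

text \<open>
  The reference solution \<open>(X, Y)\<close> is fixed, and \<open>C\<close> serves all solutions with \<open>\<nu>\<close> in the unit disc
  around \<open>\<mu>\<close>. The differences solve the system for \<open>\<nu>\<close> with the forcing term \<open>- (\<nu> - \<mu>) X / P\<close>, and on
  that disc the coefficient is dominated by one integrable function, to which the Gronwall bound applies.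
\<close>
lemma sl_solution_stability:
  assumes "a < b" and P: "P > 0" and q: "q absolutely_integrable_on {a..b}"
    and X: "sl_solution a b P q \<mu> X Y"
  obtains C where "C \<ge> 0"
    "\<And>\<nu> U V x. \<lbrakk>cmod (\<nu> - \<mu>) \<le> 1; sl_solution a b P q \<nu> U V; x \<in> {a..b}\<rbrakk> \<Longrightarrow>
       cmod (U x - X x) + cmod (V x - Y x)
         \<le> C * (cmod (U a - X a) + cmod (V a - Y a) + cmod (\<nu> - \<mu>))"
proof -
  have cX: "continuous_on {a..b} X" "continuous_on {a..b} Y" using X by (auto simp: sl_solution_def)
  obtain B where B: "B \<ge> 0" "\<And>x. x \<in> {a..b} \<Longrightarrow> norm (X x) \<le> B"
    using bounded_on_interval[OF cX(1)] by blast
  define k where "k t = (\<bar>q t\<bar> + (cmod \<mu> + 1)) / P" for t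
  define m where "m t = 1 + k t" for t
  have k0: "0 \<le> k t" for t using P by (simp add: k_def)
  have k_ai: "k absolutely_integrable_on {a..b}"
    unfolding k_def
    by (intro set_integrable_divide set_integral_add(1) set_integrable_abs q absolutely_integrable_continuous_real continuous_on_const)
  have m_ai: "m absolutely_integrable_on {a..b}"
    unfolding m_def by (intro set_integral_add(1) k_ai absolutely_integrable_continuous_real continuous_on_const)
  have prod: "(\<lambda>t. r t * f t) integrable_on {a..b}"
    if "r absolutely_integrable_on {a..b}" "continuous_on {a..b} f" for r f :: "real \<Rightarrow> real"
    using absolutely_integrable_scaleR_continuous[OF that] by (auto simp: set_lebesgue_integral_eq_integral(1))
  define n where "n = nat \<lceil>2 * integral {a..b} m\<rceil>"
  define K where "K = B / P * (b - a)"
  have "K \<ge> 0" using B P \<open>a < b\<close> by (simp add: K_def)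
  show ?thesis
  proof (rule that[of "2 ^ n * (1 + K)"])
    show "0 \<le> 2 ^ n * (1 + K)" using \<open>K \<ge> 0\<close> by simp
    fix \<nu> U V x assume \<nu>: "cmod (\<nu> - \<mu>) \<le> 1" and U: "sl_solution a b P q \<nu> U V" and x: "x \<in> {a..b}"
    have cU: "continuous_on {a..b} U" "continuous_on {a..b} V" using U by (auto simp: sl_solution_def)
    define \<delta> where "\<delta> = cmod (\<nu> - \<mu>)"
    define z where "z t = cmod (U t - X t) + cmod (V t - Y t)" for t
    define c where "c = \<delta> * B / P"
    have c0: "c \<ge> 0" using B P by (simp add: c_def \<delta>_def)
    define A where "A = z a + c * (b - a)"
    have cz: "continuous_on {a..b} z" unfolding z_def by (intro continuous_intros cU cX)
    note fU = sl_solution_integral_form[OF \<open>a < b\<close> U q]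
    note fX = sl_solution_integral_form[OF \<open>a < b\<close> X q]
    have mz: "(\<lambda>t. m t * z t) integrable_on {a..b}" by (rule prod[OF m_ai cz])
    have kU: "(\<lambda>t. k t * cmod (U t - X t)) integrable_on {a..b}"
      by (rule prod[OF k_ai]) (intro continuous_intros cU cX)
    have "z x \<le> 2 ^ n * A"
    proof (rule gronwall_bound[OF cz _ _ _ mz _ _ x])
      show "m integrable_on {a..b}" using m_ai by (simp add: set_lebesgue_integral_eq_integral(1))
      show "0 \<le> z t" for t by (simp add: z_def)
      show "0 \<le> m t" for t using k0[of t] by (simp add: m_def)
      show "0 \<le> A" using c0 \<open>a < b\<close> by (simp add: A_def z_def)
      have "integral {a..x} m \<le> integral {a..b} m"
        using x \<open>m integrable_on {a..b}\<close> \<open>\<And>t. 0 \<le> m t\<close>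
        by (intro integral_subset_le) (auto intro: integrable_on_subinterval)
      also have "\<dots> \<le> real n / 2" unfolding n_def by linarith
      finally show "integral {a..x} m \<le> real n / 2" .
    next
      fix y assume y: "y \<in> {a..b}"
      have sub: "{a..y} \<subseteq> {a..b}" using y by auto
      note int = integrable_on_subinterval[OF _ sub]
      have VY: "(\<lambda>t. V t - Y t) integrable_on {a..y}"
        using cU cX by (intro int integrable_continuous_interval continuous_intros)
      have nVY: "(\<lambda>t. cmod (V t - Y t)) integrable_on {a..y}"
        using cU cX by (intro int integrable_continuous_interval continuous_intros)
      have "U y - X y = (U a - X a) + integral {a..y} (\<lambda>t. V t - Y t)"
        using fU(2)[OF y] fX(2)[OF y] int[OF integrable_continuous_interval[OF cU(2)]]
          int[OF integrable_continuous_interval[OF cX(2)]]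
        by (simp add: Henstock_Kurzweil_Integration.integral_diff)
      also have "cmod \<dots> \<le> cmod (U a - X a) + integral {a..y} (\<lambda>t. cmod (V t - Y t))"
        by (intro norm_triangle_le add_left_mono integral_norm_bound_integral VY nVY) simp
      finally have 1: "cmod (U y - X y) \<le> cmod (U a - X a) + integral {a..y} (\<lambda>t. cmod (V t - Y t))" .
      define G where "G t = (of_real (q t) - \<nu>) * U t / of_real P - (of_real (q t) - \<mu>) * X t / of_real P" for t
      have Gi: "G integrable_on {a..y}"
        unfolding G_def using int[OF fU(1)] int[OF fX(1)] by (rule integrable_diff)
      have kUc: "(\<lambda>t. k t * cmod (U t - X t) + c) integrable_on {a..y}"
        using int[OF kU] by (intro integrable_add) auto
      have G_le: "cmod (G t) \<le> k t * cmod (U t - X t) + c" if "t \<in> {a..y}" for t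
      proof -
        have "G t = ((of_real (q t) - \<nu>) * (U t - X t) - (\<nu> - \<mu>) * X t) / of_real P"
          using P by (simp add: G_def field_simps)
        also have "cmod \<dots> \<le> (cmod (of_real (q t) - \<nu>) * cmod (U t - X t) + \<delta> * cmod (X t)) / P"
          using P norm_triangle_ineq4[of "(of_real (q t) - \<nu>) * (U t - X t)" "(\<nu> - \<mu>) * X t"]
          by (simp add: norm_divide divide_right_mono norm_mult \<delta>_def)
        also have "\<dots> \<le> ((\<bar>q t\<bar> + (cmod \<mu> + 1)) * cmod (U t - X t) + \<delta> * B) / P"
        proof (intro divide_right_mono add_mono mult_mono)
          have "cmod (of_real (q t) - \<nu>) \<le> \<bar>q t\<bar> + cmod \<nu>"
            using norm_triangle_ineq4[of "of_real (q t) :: complex" \<nu>] by simp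
          also have "cmod \<nu> \<le> cmod \<mu> + 1"
            using \<nu> norm_triangle_ineq[of "\<nu> - \<mu>" \<mu>] by simp
          finally show "cmod (of_real (q t) - \<nu>) \<le> \<bar>q t\<bar> + (cmod \<mu> + 1)" by simp
          show "cmod (X t) \<le> B" using B(2) that sub by auto
        qed (use P B in \<open>auto simp: \<delta>_def\<close>)
        also have "\<dots> = k t * cmod (U t - X t) + c" using P by (simp add: k_def c_def field_simps)
        finally show ?thesis .
      qed
      have "V y - Y y = (V a - Y a) + integral {a..y} G"
        unfolding G_def Henstock_Kurzweil_Integration.integral_diff[OF int[OF fU(1)] int[OF fX(1)]]
        using fU(3)[OF y] fX(3)[OF y] by simp
      also have "cmod \<dots> \<le> cmod (V a - Y a) + integral {a..y} (\<lambda>t. k t * cmod (U t - X t) + c)"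
        by (intro norm_triangle_le add_left_mono integral_norm_bound_integral Gi kUc G_le)
      finally have 2: "cmod (V y - Y y) \<le> cmod (V a - Y a) + integral {a..y} (\<lambda>t. k t * cmod (U t - X t) + c)" .
      have "z y \<le> z a + (integral {a..y} (\<lambda>t. cmod (V t - Y t))
          + integral {a..y} (\<lambda>t. k t * cmod (U t - X t) + c))"
        using 1 2 by (simp add: z_def)
      also have "integral {a..y} (\<lambda>t. cmod (V t - Y t)) + integral {a..y} (\<lambda>t. k t * cmod (U t - X t) + c)
          = integral {a..y} (\<lambda>t. cmod (V t - Y t) + (k t * cmod (U t - X t) + c))"
        using nVY kUc by (simp add: Henstock_Kurzweil_Integration.integral_add)
      also have "\<dots> \<le> integral {a..y} (\<lambda>t. m t * z t + c)"
      proof (rule integral_le)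
        show "(\<lambda>t. m t * z t + c) integrable_on {a..y}" using int[OF mz] by (intro integrable_add) auto
        show "cmod (V t - Y t) + (k t * cmod (U t - X t) + c) \<le> m t * z t + c" for t
          using k0[of t] by (simp add: m_def z_def algebra_simps)
      qed (intro integrable_add nVY kUc)
      also have "\<dots> = integral {a..y} (\<lambda>t. m t * z t) + c * (y - a)"
        using y Henstock_Kurzweil_Integration.integral_add[OF int[OF mz] integrable_const_ivl[of c a y]]
        by simp
      also have "c * (y - a) \<le> c * (b - a)" using y c0 by (intro mult_left_mono) auto
      finally show "z y \<le> A + integral {a..y} (\<lambda>t. m t * z t)" by (simp add: A_def)
    qed
    also have "A \<le> (1 + K) * (z a + \<delta>)"
    proof -
      have "c * (b - a) = K * \<delta>" by (simp add: c_def K_def)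
      moreover have "0 \<le> K * z a" "0 \<le> \<delta>" using \<open>K \<ge> 0\<close> by (auto simp: z_def \<delta>_def)
      ultimately show ?thesis by (simp add: A_def algebra_simps)
    qed
    finally show "cmod (U x - X x) + cmod (V x - Y x)
         \<le> 2 ^ n * (1 + K) * (cmod (U a - X a) + cmod (V a - Y a) + cmod (\<nu> - \<mu>))"
      by (simp add: z_def \<delta>_def mult.assoc)
  qed
qed

section \<open>The transmission problem, piece by piece\<close>

text \<open>
  Continuous extension of \<open>f\<close> from \<open>(a, b)\<close> to \<open>[a, b]\<close>. Limits are used also at an endpoint where
  \<open>f\<close> has a value, since at \<open>h j\<close> that value is arbitrary.
\<close>
definition closed_ext :: "real \<Rightarrow> real \<Rightarrow> (real \<Rightarrow> 'a::t2_space) \<Rightarrow> real \<Rightarrow> 'a" where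
  "closed_ext a b f x =
     (if x \<le> a then Lim (at_right a) f else if b \<le> x then Lim (at_left b) f else f x)"

lemma closed_ext_inside: "x \<in> {a<..<b} \<Longrightarrow> closed_ext a b f x = f x"
  by (simp add: closed_ext_def)

lemma closed_ext_left: "(f \<longlongrightarrow> l) (at_right a) \<Longrightarrow> closed_ext a b f a = l"
  by (simp add: closed_ext_def tendsto_Lim)

lemma closed_ext_right: "a < b \<Longrightarrow> (f \<longlongrightarrow> l) (at_left b) \<Longrightarrow> closed_ext a b f b = l"
  by (simp add: closed_ext_def tendsto_Lim)

lemma continuous_on_closed_ext:
  fixes f :: "real \<Rightarrow> 'a::t3_space"
  assumes "a < b" and cont: "continuous_on {a<..<b} f"
    and la: "(f \<longlongrightarrow> la) (at_right a)" and lb: "(f \<longlongrightarrow> lb) (at_left b)"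
  shows "continuous_on {a..b} (closed_ext a b f)"
proof (rule continuous_on_IccI[OF _ _ _ \<open>a < b\<close>])
  have "eventually (\<lambda>x. x \<in> {a<..<b}) (at_right a)" "eventually (\<lambda>x. x \<in> {a<..<b}) (at_left b)"
    using \<open>a < b\<close> by (auto intro: eventually_at_rightI eventually_at_leftI)
  then have ev: "eventually (\<lambda>x. f x = closed_ext a b f x) (at_right a)"
    "eventually (\<lambda>x. f x = closed_ext a b f x) (at_left b)"
    by (auto elim!: eventually_mono simp: closed_ext_inside)
  show "(closed_ext a b f \<longlongrightarrow> closed_ext a b f a) (at_right a)"
    using tendsto_cong[OF ev(1)] la closed_ext_left[OF la, of b] by simp
  show "(closed_ext a b f \<longlongrightarrow> closed_ext a b f b) (at_left b)"
    using tendsto_cong[OF ev(2)] lb closed_ext_right[OF \<open>a < b\<close> lb] by simp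
  show "closed_ext a b f \<midarrow>x\<rightarrow> closed_ext a b f x" if "a < x" "x < b" for x
  proof -
    have "continuous_on {a<..<b} (closed_ext a b f)"
      using cont by (rule continuous_on_eq) (simp add: closed_ext_inside)
    then show ?thesis using that
      by (simp add: continuous_on_eq_continuous_at isCont_def)
  qed
qed

locale transmission_problem =
  fixes h p \<alpha> \<beta> :: "nat \<Rightarrow> real" and q :: "real \<Rightarrow> real"
  assumes h: "-1 < h 1" "h 1 < h 2" "h 2 < h 3" "h 3 < 1"
    and p: "p 1 \<noteq> 0" "p 2 \<noteq> 0" "p 3 \<noteq> 0" "p 4 \<noteq> 0"
    and q: "q absolutely_integrable_on dom_I h"
    and det: "\<alpha> 3 * \<beta> 4 - \<beta> 3 * \<alpha> 4 > 0" "\<alpha> 5 * \<beta> 6 - \<beta> 5 * \<alpha> 6 > 0"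
      "\<alpha> 7 * \<beta> 8 - \<beta> 7 * \<alpha> 8 > 0"
begin

definition knot :: "nat \<Rightarrow> real" where
  "knot i = (if i = 0 then -1 else if i = 4 then 1 else h i)"

lemma knot_simps: "knot 0 = -1" "knot 1 = h 1" "knot (Suc 0) = h 1" "knot 2 = h 2" "knot 3 = h 3" "knot 4 = 1"
  by (simp_all add: knot_def)

lemma piece_cases:
  assumes "i \<in> {1..4}"
  obtains "i = 1" | "i = 2" | "i = 3" | "i = (4::nat)"
  using assms by (auto simp: numeral_eq_Suc le_Suc_eq)

lemma knot_less: "i \<in> {1..4} \<Longrightarrow> knot (i - 1) < knot i"
  by (erule piece_cases) (use h in \<open>auto simp: knot_simps\<close>)

lemma p_pos: "i \<in> {1..4} \<Longrightarrow> (p i)\<^sup>2 > 0"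
  by (erule piece_cases) (use p in auto)

lemma piece_in_subinterval: "i \<in> {1..4} \<Longrightarrow> \<exists>J\<in>subintervals h. {knot (i - 1)<..<knot i} \<subseteq> J"
  by (erule piece_cases) (auto simp: knot_simps subintervals_def)

lemma piece_subset_dom: "i \<in> {1..4} \<Longrightarrow> {knot (i - 1)<..<knot i} \<subseteq> dom_I h"
  using piece_in_subinterval unfolding dom_I_def by blast

lemma dom_I_cases:
  assumes "x \<in> dom_I h"
  obtains "x = -1" | "x = 1" | i where "i \<in> {1..4}" "x \<in> {knot (i - 1)<..<knot i}"
proof -
  have "x = -1 \<or> x = 1 \<or> x \<in> {knot (1 - 1)<..<knot 1} \<or> x \<in> {knot (2 - 1)<..<knot 2}
      \<or> x \<in> {knot (3 - 1)<..<knot 3} \<or> x \<in> {knot (4 - 1)<..<knot 4}"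
    using assms h by (auto simp: dom_I_def subintervals_def knot_simps)
  moreover have "{1, 2, 3, 4} \<subseteq> {1..4::nat}" by auto
  ultimately show ?thesis using that by (meson insert_subset)
qed

lemma coeff_p_piece: "i \<in> {1..4} \<Longrightarrow> x \<in> {knot (i - 1)<..<knot i} \<Longrightarrow> coeff_p h p x = (p i)\<^sup>2"
  by (erule piece_cases) (use h in \<open>auto simp: knot_simps coeff_p_def\<close>)

lemma q_integrable_piece:
  assumes "i \<in> {1..4}"
  shows "q absolutely_integrable_on {knot (i - 1)..knot i}"
proof -
  have "q absolutely_integrable_on {knot (i - 1)<..<knot i}"
    by (rule set_integrable_subset[OF q _ piece_subset_dom[OF assms]]) simp
  then show ?thesis
    using absolutely_integrable_on_open_interval[where f = q and a = "knot (i - 1)" and b = "knot i"] by simp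
qed

text \<open>
  The boundary condition at \<open>-1\<close> leaves a line of initial data, so two solutions that satisfy
  it are proportional.
\<close>
lemma proportional_initial_data:
  fixes a b :: complex
  assumes "\<bar>\<alpha> 1\<bar> + \<bar>\<alpha> 2\<bar> \<noteq> 0" and "\<alpha> 1 * a + \<alpha> 2 * b = 0"
  obtains k :: complex where "a = k * \<alpha> 2" "b = k * (- \<alpha> 1)"
proof (cases "\<alpha> 2 = 0")
  case True
  with assms show ?thesis by (intro that[of "b / (- \<alpha> 1)"]) auto
next
  case False
  have "\<alpha> 2 * b = - \<alpha> 1 * a" using assms(2) by (simp add: eq_neg_iff_add_eq_0 add.commute)
  with False show ?thesis by (intro that[of "a / \<alpha> 2"]) (auto simp: field_simps)
qed

text \<open>
  A solution of the equation and the transmission conditions as a family of four solutions, \<open>U i\<close> and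
  \<open>V i\<close> on the closed interval from \<open>knot (i - 1)\<close> to \<open>knot i\<close>. The one-sided limits at \<open>h j\<close> become
  values of the pieces \<open>j\<close> and \<open>j + 1\<close> at their common endpoint.
\<close>
definition piece_solution :: "complex \<Rightarrow> (nat \<Rightarrow> real \<Rightarrow> complex) \<Rightarrow> (nat \<Rightarrow> real \<Rightarrow> complex) \<Rightarrow> bool" where
  "piece_solution \<nu> U V \<longleftrightarrow>
     (\<forall>i\<in>{1..4}. sl_solution (knot (i - 1)) (knot i) ((p i)\<^sup>2) q \<nu> (U i) (V i)) \<and>
     (\<forall>j\<in>{1..3}.
        U (Suc j) (knot j) = \<alpha> (2*j + 1) *\<^sub>R U j (knot j) + \<beta> (2*j + 1) *\<^sub>R V j (knot j) \<and>
        V (Suc j) (knot j) = \<alpha> (2*j + 2) *\<^sub>R U j (knot j) + \<beta> (2*j + 2) *\<^sub>R V j (knot j))"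

definition pieces :: "(real \<Rightarrow> complex) \<Rightarrow> nat \<Rightarrow> real \<Rightarrow> complex" where
  "pieces f i = closed_ext (knot (i - 1)) (knot i) f"

lemma pieces_inside: "x \<in> {knot (i - 1)<..<knot i} \<Longrightarrow> pieces f i x = f x"
  by (simp add: pieces_def closed_ext_inside)

lemma sl_solution_pieces:
  assumes i: "i \<in> {1..4}" and eq: "solves_equation h p q \<nu> u"
    and lim: "(u \<longlongrightarrow> ul) (at_right (knot (i - 1)))" "(D_I h u \<longlongrightarrow> dl) (at_right (knot (i - 1)))"
      "(u \<longlongrightarrow> ur) (at_left (knot i))" "(D_I h u \<longlongrightarrow> dr) (at_left (knot i))"
  shows "sl_solution (knot (i - 1)) (knot i) ((p i)\<^sup>2) q \<nu> (pieces u i) (pieces (D_I h u) i)"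
proof -
  let ?a = "knot (i - 1)" and ?b = "knot i"
  have ab: "?a < ?b" using knot_less[OF i] .
  obtain J where J: "J \<in> subintervals h" "{?a<..<?b} \<subseteq> J" using piece_in_subinterval[OF i] by blast
  have ac: "abs_continuous_on {?a<..<?b} u" "abs_continuous_on {?a<..<?b} (D_I h u)"
    using eq J by (auto simp: solves_equation_def intro: abs_continuous_on_subset)
  have cont: "continuous_on {?a<..<?b} u" "continuous_on {?a<..<?b} (D_I h u)"
    using ac by (auto intro!: abs_continuous_on_imp_continuous_on simp: is_interval_1)
  have at: "at x within dom_I h = at x" if "x \<in> {?a<..<?b}" for x
    using that piece_subset_dom[OF i] by (intro at_within_open_subset[of _ "{?a<..<?b}"]) auto
  have P: "(p i)\<^sup>2 > 0" using p_pos[OF i] .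
  have "AE x in lebesgue. x \<in> dom_I h \<longrightarrow>
        (\<exists>d. ((\<lambda>t. coeff_p h p t *\<^sub>R D_I h u t) has_vector_derivative d) (at x within dom_I h) \<and>
             - d + q x *\<^sub>R u x = \<nu> * u x)"
    using eq by (simp add: solves_equation_def)
  then obtain N where N: "N \<in> null_sets lebesgue" "\<And>x. x \<notin> N \<Longrightarrow> x \<in> dom_I h \<Longrightarrow>
        (\<exists>d. ((\<lambda>t. coeff_p h p t *\<^sub>R D_I h u t) has_vector_derivative d) (at x within dom_I h) \<and>
             - d + q x *\<^sub>R u x = \<nu> * u x)"
    unfolding completion.AE_iff_null_sets by auto
  show ?thesis
    unfolding sl_solution_def pieces_def
  proof (intro conjI ballI exI[of _ N])
    show "continuous_on {?a..?b} (closed_ext ?a ?b u)"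
      by (rule continuous_on_closed_ext[OF ab cont(1) lim(1,3)])
    show "continuous_on {?a..?b} (closed_ext ?a ?b (D_I h u))"
      by (rule continuous_on_closed_ext[OF ab cont(2) lim(2,4)])
    show "abs_continuous_on {?a<..<?b} (closed_ext ?a ?b u)"
      by (rule abs_continuous_on_cong[OF _ ac(1)]) (simp add: closed_ext_inside)
    show "abs_continuous_on {?a<..<?b} (closed_ext ?a ?b (D_I h u))"
      by (rule abs_continuous_on_cong[OF _ ac(2)]) (simp add: closed_ext_inside)
    show "negligible N" using N(1) negligible_iff_null_sets by blast
  next
    fix x assume x: "x \<in> {?a<..<?b}"
    then have "x \<in> dom_I h" using piece_subset_dom[OF i] by blast
    then have "(u has_vector_derivative D_I h u x) (at x within dom_I h)"
      using eq unfolding solves_equation_def differentiable_on_def D_I_def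
      by (simp add: vector_derivative_works)
    then have "(u has_vector_derivative D_I h u x) (at x)" using at[OF x] by simp
    then have "(closed_ext ?a ?b u has_vector_derivative D_I h u x) (at x)"
      by (rule has_vector_derivative_transform_within_open[of _ _ _ "{?a<..<?b}"])
         (use x in \<open>auto simp: closed_ext_inside\<close>)
    then show "(closed_ext ?a ?b u has_vector_derivative closed_ext ?a ?b (D_I h u) x) (at x)"
      using x by (simp add: closed_ext_inside)
  next
    fix x assume x: "x \<in> {?a<..<?b} - N"
    then have xd: "x \<in> dom_I h" "x \<notin> N" using piece_subset_dom[OF i] by auto
    from N(2)[OF xd(2,1)] at[of x] x obtain d where
      d: "((\<lambda>t. coeff_p h p t *\<^sub>R D_I h u t) has_vector_derivative d) (at x)"
        "- d + q x *\<^sub>R u x = \<nu> * u x" by auto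
    have "((\<lambda>t. inverse ((p i)\<^sup>2) *\<^sub>R (coeff_p h p t *\<^sub>R D_I h u t)) has_vector_derivative
        inverse ((p i)\<^sup>2) *\<^sub>R d) (at x)"
      using bounded_linear.has_vector_derivative[OF bounded_linear_scaleR_right d(1)] .
    then have "(closed_ext ?a ?b (D_I h u) has_vector_derivative inverse ((p i)\<^sup>2) *\<^sub>R d) (at x)"
      by (rule has_vector_derivative_transform_within_open[of _ _ _ "{?a<..<?b}"])
         (use x P in \<open>auto simp: closed_ext_inside coeff_p_piece[OF i]\<close>)
    moreover have "inverse ((p i)\<^sup>2) *\<^sub>R d
        = (of_real (q x) - \<nu>) * closed_ext ?a ?b u x / of_real ((p i)\<^sup>2)"
    proof -
      have "d = (of_real (q x) - \<nu>) * u x" using d(2) by (simp add: scaleR_conv_of_real algebra_simps)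
      then show ?thesis using x by (simp add: closed_ext_inside scaleR_conv_of_real divide_inverse mult.commute)
    qed
    ultimately show "(closed_ext ?a ?b (D_I h u) has_vector_derivative
        (of_real (q x) - \<nu>) * closed_ext ?a ?b u x / of_real ((p i)\<^sup>2)) (at x)" by simp
  qed
qed

text \<open>
  The limits needed at the interior points are part of the transmission conditions. At \<open>-1\<close> and \<open>1\<close> they
  exist because absolute continuity on the half-open end pieces includes continuity at these points.
\<close>
lemma piece_solution_pieces:
  assumes eq: "solves_equation h p q \<nu> u" and tr: "transmission h \<alpha> \<beta> u"
  shows "piece_solution \<nu> (pieces u) (pieces (D_I h u))"
    and "pieces u 1 (-1) = u (-1)" "pieces (D_I h u) 1 (-1) = D_I h u (-1)"
    and "pieces u 4 1 = u 1" "pieces (D_I h u) 4 1 = D_I h u 1"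
proof -
  have ac: "abs_continuous_on J u" "abs_continuous_on J (D_I h u)" if "J \<in> subintervals h" for J
    using eq that by (auto simp: solves_equation_def)
  have lim_l: "(f \<longlongrightarrow> f (-1)) (at_right (-1))" if "abs_continuous_on {-1..<h 1} f" for f :: "real \<Rightarrow> complex"
  proof -
    have "continuous_on {-1..<h 1} f"
      using abs_continuous_on_imp_continuous_on[OF that] by (simp add: is_interval_1)
    then have "(f \<longlongrightarrow> f (-1)) (at (-1) within {-1..<h 1})" using h by (auto simp: continuous_on_def)
    then have "(f \<longlongrightarrow> f (-1)) (at (-1) within {-1..(h 1 - 1) / 2})"
      by (rule tendsto_within_subset) (use h in auto)
    then show ?thesis using h by (simp add: at_within_Icc_at_right)
  qed
  have lim_r: "(f \<longlongrightarrow> f 1) (at_left 1)" if "abs_continuous_on {h 3<..1} f" for f :: "real \<Rightarrow> complex"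
  proof -
    have "continuous_on {h 3<..1} f"
      using abs_continuous_on_imp_continuous_on[OF that] by (simp add: is_interval_1)
    then have "(f \<longlongrightarrow> f 1) (at 1 within {h 3<..1})" using h by (auto simp: continuous_on_def)
    then have "(f \<longlongrightarrow> f 1) (at 1 within {(h 3 + 1) / 2..1})"
      by (rule tendsto_within_subset) (use h in auto)
    then show ?thesis using h by (simp add: at_within_Icc_at_left)
  qed
  have L: "(u \<longlongrightarrow> u (-1)) (at_right (knot 0))" "(D_I h u \<longlongrightarrow> D_I h u (-1)) (at_right (knot 0))"
    and R: "(u \<longlongrightarrow> u 1) (at_left (knot 4))" "(D_I h u \<longlongrightarrow> D_I h u 1) (at_left (knot 4))"
    using lim_l lim_r ac by (auto simp: subintervals_def knot_simps)
  define ul dl where "ul j = Lim (at_left (knot j)) u" and "dl j = Lim (at_left (knot j)) (D_I h u)" for j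
  have T: "(u \<longlongrightarrow> ul j) (at_left (knot j))" "(D_I h u \<longlongrightarrow> dl j) (at_left (knot j))"
    "(u \<longlongrightarrow> \<alpha> (2*j + 1) *\<^sub>R ul j + \<beta> (2*j + 1) *\<^sub>R dl j) (at_right (knot j))"
    "(D_I h u \<longlongrightarrow> \<alpha> (2*j + 2) *\<^sub>R ul j + \<beta> (2*j + 2) *\<^sub>R dl j) (at_right (knot j))"
    if "j \<in> {1..3}" for j
  proof -
    have j: "j \<in> {1, 2, 3}" "knot j = h j" using that by (auto simp: knot_def)
    with tr obtain a b where *: "(u \<longlongrightarrow> a) (at_left (h j))" "(D_I h u \<longlongrightarrow> b) (at_left (h j))"
      "(u \<longlongrightarrow> \<alpha> (2*j + 1) *\<^sub>R a + \<beta> (2*j + 1) *\<^sub>R b) (at_right (h j))"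
      "(D_I h u \<longlongrightarrow> \<alpha> (2*j + 2) *\<^sub>R a + \<beta> (2*j + 2) *\<^sub>R b) (at_right (h j))"
      unfolding transmission_def by meson
    have "ul j = a" "dl j = b" using * j by (auto simp: ul_def dl_def intro: tendsto_Lim)
    with * j show "(u \<longlongrightarrow> ul j) (at_left (knot j))" "(D_I h u \<longlongrightarrow> dl j) (at_left (knot j))"
      "(u \<longlongrightarrow> \<alpha> (2*j + 1) *\<^sub>R ul j + \<beta> (2*j + 1) *\<^sub>R dl j) (at_right (knot j))"
      "(D_I h u \<longlongrightarrow> \<alpha> (2*j + 2) *\<^sub>R ul j + \<beta> (2*j + 2) *\<^sub>R dl j) (at_right (knot j))" by simp_all
  qed
  have sol: "sl_solution (knot (i - 1)) (knot i) ((p i)\<^sup>2) q \<nu> (pieces u i) (pieces (D_I h u) i)"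
    if i: "i \<in> {1..4}" for i
  proof -
    have "\<exists>l d. (u \<longlongrightarrow> l) (at_right (knot (i - 1))) \<and> (D_I h u \<longlongrightarrow> d) (at_right (knot (i - 1)))"
    proof (cases "i = 1")
      case True then show ?thesis using L by auto
    next
      case False
      then have "i - 1 \<in> {1..3}" using i by auto
      from T(3,4)[OF this] show ?thesis by blast
    qed
    moreover have "\<exists>l d. (u \<longlongrightarrow> l) (at_left (knot i)) \<and> (D_I h u \<longlongrightarrow> d) (at_left (knot i))"
    proof (cases "i = 4")
      case True then show ?thesis using R by auto
    next
      case False
      then have "i \<in> {1..3}" using i by auto
      from T(1,2)[OF this] show ?thesis by blast
    qed
    ultimately show ?thesis using sl_solution_pieces[OF i eq] by blast
  qed
  have right: "pieces f j (knot j) = l" if "j \<in> {1..4}" "(f \<longlongrightarrow> l) (at_left (knot j))" for f j l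
    using closed_ext_right[OF knot_less[OF that(1)] that(2)] by (simp add: pieces_def)
  have left: "pieces f (Suc j) (knot j) = l" if "(f \<longlongrightarrow> l) (at_right (knot j))" for f j l
    using closed_ext_left[OF that] by (simp add: pieces_def)
  show "piece_solution \<nu> (pieces u) (pieces (D_I h u))"
    unfolding piece_solution_def
  proof (intro conjI ballI)
    fix j :: nat assume j: "j \<in> {1..3}"
    then have j': "j \<in> {1..4}" by auto
    have e: "pieces u j (knot j) = ul j" "pieces (D_I h u) j (knot j) = dl j"
      using right[OF j'] T(1,2)[OF j] by auto
    show "pieces u (Suc j) (knot j)
        = \<alpha> (2*j + 1) *\<^sub>R pieces u j (knot j) + \<beta> (2*j + 1) *\<^sub>R pieces (D_I h u) j (knot j)"
      unfolding e using left T(3)[OF j] by blast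
    show "pieces (D_I h u) (Suc j) (knot j)
        = \<alpha> (2*j + 2) *\<^sub>R pieces u j (knot j) + \<beta> (2*j + 2) *\<^sub>R pieces (D_I h u) j (knot j)"
      unfolding e using left T(4)[OF j] by blast
  qed (use sol in blast)
  show "pieces u 1 (-1) = u (-1)" "pieces (D_I h u) 1 (-1) = D_I h u (-1)"
    using left[OF L(1)] left[OF L(2)] by (simp_all add: knot_simps)
  show "pieces u 4 1 = u 1" "pieces (D_I h u) 4 1 = D_I h u 1"
    using right[OF _ R(1)] right[OF _ R(2)] by (simp_all add: knot_simps)
qed

section \<open>The weighted Lagrange identity across the interior points\<close>

definition transmission_det :: "nat \<Rightarrow> real" where
  "transmission_det j = \<alpha> (2*j + 1) * \<beta> (2*j + 2) - \<beta> (2*j + 1) * \<alpha> (2*j + 2)"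

text \<open>
  The weights are fixed, up to a common factor, by the requirement that \<open>weight i\<close> times the Wronskian
  of piece \<open>i\<close> be continuous across the interior points. The product is empty for the last piece.
\<close>
definition weight :: "nat \<Rightarrow> real" where
  "weight i = (\<Prod>j\<in>{i..<4}. transmission_det j)"

lemma transmission_det_pos: "j \<in> {1..3} \<Longrightarrow> transmission_det j > 0"
  using det by (auto simp: transmission_det_def numeral_eq_Suc le_Suc_eq)

lemma weight_pos: "i \<ge> 1 \<Longrightarrow> weight i > 0"
  unfolding weight_def by (intro prod_pos transmission_det_pos) auto

lemma weight_4: "weight 4 = 1"
  by (simp add: weight_def)

lemma weight_Suc: "j \<in> {1..3} \<Longrightarrow> weight j = transmission_det j * weight (Suc j)"
  unfolding weight_def by (subst prod.atLeast_Suc_lessThan) auto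

definition piece_wronskian :: "(nat \<Rightarrow> real \<Rightarrow> complex) \<Rightarrow> (nat \<Rightarrow> real \<Rightarrow> complex) \<Rightarrow> (nat \<Rightarrow> real \<Rightarrow> complex)
    \<Rightarrow> (nat \<Rightarrow> real \<Rightarrow> complex) \<Rightarrow> nat \<Rightarrow> real \<Rightarrow> complex" where
  "piece_wronskian U V X Y i x = U i x * Y i x - V i x * X i x"

text \<open>
  Bilinear, without a complex conjugate: the characteristic function is to be holomorphic in the
  parameter. The factor \<open>1 / (p i)\<^sup>2\<close> appears because Lagrange's identity on piece \<open>i\<close> concerns
  \<open>(p i)\<^sup>2\<close> times the Wronskian.
\<close>
definition pairing :: "(nat \<Rightarrow> real \<Rightarrow> complex) \<Rightarrow> (nat \<Rightarrow> real \<Rightarrow> complex) \<Rightarrow> complex" where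
  "pairing U X = (\<Sum>i = 1..4. of_real (weight i / (p i)\<^sup>2) * integral {knot (i - 1)..knot i} (\<lambda>t. U i t * X i t))"

lemma piece_solution_continuous:
  assumes "piece_solution \<nu> U V" "i \<in> {1..4}"
  shows "continuous_on {knot (i - 1)..knot i} (U i)"
  using assms by (auto simp: piece_solution_def sl_solution_def)

lemma pairing_cong:
  assumes "\<And>i x. i \<in> {1..4} \<Longrightarrow> x \<in> {knot (i - 1)..knot i} \<Longrightarrow> X i x = Y i x"
  shows "pairing U X = pairing U Y"
  unfolding pairing_def using assms
  by (intro sum.cong arg_cong[where f = "\<lambda>z. _ * z"] Henstock_Kurzweil_Integration.integral_cong refl) auto

lemma pairing_scale: "pairing U (\<lambda>i x. c * X i x) = c * pairing U X"
proof -
  have "integral S (\<lambda>t. U i t * (c * X i t)) = c * integral S (\<lambda>t. U i t * X i t)" for S i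
    using integral_mult_right[of S c "\<lambda>t. U i t * X i t"] by (simp add: mult_ac)
  then show ?thesis unfolding pairing_def sum_distrib_left by (simp add: mult_ac)
qed

lemma pairing_cnj_nonneg:
  assumes "piece_solution \<nu> U V"
  shows "\<exists>r\<ge>0. pairing U (\<lambda>i x. cnj (U i x)) = complex_of_real r"
proof -
  let ?I = "\<lambda>i. integral {knot (i - 1)..knot i} (\<lambda>t. (cmod (U i t))\<^sup>2)"
  have int: "(\<lambda>t. (cmod (U i t))\<^sup>2) integrable_on {knot (i - 1)..knot i}" if "i \<in> {1..4}" for i
    using piece_solution_continuous[OF assms that] by (intro integrable_continuous_interval continuous_intros)
  have eq: "integral {knot (i - 1)..knot i} (\<lambda>t. U i t * cnj (U i t)) = of_real (?I i)" if "i \<in> {1..4}" for i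
    using has_integral_of_real[OF integrable_integral[OF int[OF that]], where 'b = complex]
    by (intro integral_unique) (simp flip: complex_norm_square)
  have "0 \<le> (\<Sum>i = 1..4. weight i / (p i)\<^sup>2 * ?I i)"
    using weight_pos by (intro sum_nonneg mult_nonneg_nonneg divide_nonneg_nonneg
        Henstock_Kurzweil_Integration.integral_nonneg int) (auto intro: less_imp_le)
  moreover have "pairing U (\<lambda>i x. cnj (U i x)) = complex_of_real (\<Sum>i = 1..4. weight i / (p i)\<^sup>2 * ?I i)"
    unfolding pairing_def of_real_sum by (intro sum.cong refl) (simp add: eq[simplified])
  ultimately show ?thesis by blast
qed

lemma piece_wronskian_jump:
  assumes "piece_solution \<nu> U V" "piece_solution \<mu> X Y" "j \<in> {1..3}"
  shows "piece_wronskian U V X Y (Suc j) (knot j) = transmission_det j * piece_wronskian U V X Y j (knot j)"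
  using assms by (simp add: piece_solution_def piece_wronskian_def transmission_det_def scaleR_conv_of_real algebra_simps)

text \<open>
  The identities of the pieces telescope, because the weights cancel the determinants picked up at the
  interior points.
\<close>
lemma lagrange_identity_pieces:
  assumes U: "piece_solution \<nu> U V" and X: "piece_solution \<mu> X Y"
  shows "piece_wronskian U V X Y 4 1 - weight 1 * piece_wronskian U V X Y 1 (-1) = (\<nu> - \<mu>) * pairing U X"
proof -
  let ?W = "piece_wronskian U V X Y"
  let ?S = "\<lambda>i. of_real (weight i / (p i)\<^sup>2) * integral {knot (i - 1)..knot i} (\<lambda>t. U i t * X i t)"
  have piece: "weight i * ?W i (knot i) - weight i * ?W i (knot (i - 1)) = (\<nu> - \<mu>) * ?S i"
    if i: "i \<in> {1..4}" for i
  proof -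
    have "of_real ((p i)\<^sup>2) * ?W i (knot i) - of_real ((p i)\<^sup>2) * ?W i (knot (i - 1))
        = (\<nu> - \<mu>) * integral {knot (i - 1)..knot i} (\<lambda>t. U i t * X i t)"
      unfolding piece_wronskian_def using U X i knot_less[OF i] p_pos[OF i]
      by (intro lagrange_identity) (auto simp: piece_solution_def)
    then have "complex_of_real (weight i / (p i)\<^sup>2) * (of_real ((p i)\<^sup>2) * ?W i (knot i) - of_real ((p i)\<^sup>2) * ?W i (knot (i - 1)))
        = complex_of_real (weight i / (p i)\<^sup>2)
          * ((\<nu> - \<mu>) * integral {knot (i - 1)..knot i} (\<lambda>t. U i t * X i t))" by simp
    then show ?thesis using p_pos[OF i] by (simp add: field_simps)
  qed
  have "weight k * ?W k (knot k) - weight 1 * ?W 1 (knot 0) = (\<nu> - \<mu>) * (\<Sum>i = 1..k. ?S i)"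
    if "1 \<le> k" "k \<le> 4" for k
    using that
  proof (induction k rule: nat_induct_at_least)
    case base
    then show ?case using piece[of 1] by simp
  next
    case (Suc k)
    then have k: "k \<in> {1..3}" "Suc k \<in> {1..4}" by auto
    have "weight (Suc k) * ?W (Suc k) (knot k) = weight k * ?W k (knot k)"
      using piece_wronskian_jump[OF U X k(1)] weight_Suc[OF k(1)] by simp
    then show ?case using piece[OF k(2)] Suc by (simp add: algebra_simps)
  qed
  from this[of 4] show ?thesis by (simp add: pairing_def knot_simps weight_4)
qed

lemma piece_wronskian_constant_first_piece:
  assumes U: "piece_solution \<nu> U V" and X: "piece_solution \<nu> X Y" and x: "x \<in> {-1..h 1}"
  shows "piece_wronskian U V X Y 1 x = piece_wronskian U V X Y 1 (-1)"
proof -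
  have "of_real ((p 1)\<^sup>2) * piece_wronskian U V X Y 1 x - of_real ((p 1)\<^sup>2) * piece_wronskian U V X Y 1 (-1) = (\<nu> - \<nu>) * integral {-1..x} (\<lambda>t. U 1 t * X 1 t)"
    unfolding piece_wronskian_def using U X knot_less[of 1] p_pos[of 1] x h
    by (intro lagrange_identity[where b = "h 1"]) (auto simp: piece_solution_def knot_simps dest!: bspec[of _ _ 1])
  then show ?thesis using p by simp
qed

section \<open>Dependence of solutions on the eigenparameter\<close>

text \<open>
  The single-interval estimate propagates from left to right: a transmission condition enlarges a
  difference of solutions at most by the sum of the absolute values of its coefficients.
\<close>
lemma piece_solution_stability:
  assumes X: "piece_solution \<mu> X Y"
  obtains C where "C \<ge> 0"
    "\<And>\<nu> U V i x. \<lbrakk>cmod (\<nu> - \<mu>) \<le> 1; piece_solution \<nu> U V; i \<in> {1..4}; x \<in> {knot (i - 1)..knot i}\<rbrakk> \<Longrightarrow>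
       cmod (U i x - X i x) + cmod (V i x - Y i x)
         \<le> C * (cmod (U 1 (-1) - X 1 (-1)) + cmod (V 1 (-1) - Y 1 (-1)) + cmod (\<nu> - \<mu>))"
proof -
  define d where "d U V i x = cmod (U i x - X i x) + cmod (V i x - Y i x)" for U V :: "nat \<Rightarrow> real \<Rightarrow> complex" and i x
  have d0: "d U V i x \<ge> 0" for U V i x by (simp add: d_def)
  have one: "\<exists>C\<ge>0. \<forall>\<nu> U V x. cmod (\<nu> - \<mu>) \<le> 1 \<and> piece_solution \<nu> U V \<and> x \<in> {knot (i - 1)..knot i} \<longrightarrow>
      d U V i x \<le> C * (d U V i (knot (i - 1)) + cmod (\<nu> - \<mu>))" if i: "i \<in> {1..4}" for i
  proof -
    have "sl_solution (knot (i - 1)) (knot i) ((p i)\<^sup>2) q \<mu> (X i) (Y i)"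
      using X i by (auto simp: piece_solution_def)
    from sl_solution_stability[OF knot_less[OF i] p_pos[OF i] q_integrable_piece[OF i] this]
    obtain C where C: "C \<ge> 0"
      "\<And>\<nu> U V x. \<lbrakk>cmod (\<nu> - \<mu>) \<le> 1; sl_solution (knot (i - 1)) (knot i) ((p i)\<^sup>2) q \<nu> U V;
          x \<in> {knot (i - 1)..knot i}\<rbrakk> \<Longrightarrow>
       cmod (U x - X i x) + cmod (V x - Y i x)
         \<le> C * (cmod (U (knot (i - 1)) - X i (knot (i - 1))) + cmod (V (knot (i - 1)) - Y i (knot (i - 1)))
              + cmod (\<nu> - \<mu>))" by metis
    show ?thesis
    proof (intro exI[of _ C] conjI allI impI)
      fix \<nu> U V x assume A: "cmod (\<nu> - \<mu>) \<le> 1 \<and> piece_solution \<nu> U V \<and> x \<in> {knot (i - 1)..knot i}"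
      then show "d U V i x \<le> C * (d U V i (knot (i - 1)) + cmod (\<nu> - \<mu>))"
        unfolding d_def using i by (intro C(2)) (auto simp: piece_solution_def)
    qed (fact C(1))
  qed
  have "\<exists>C\<ge>0. \<forall>\<nu> U V i x. cmod (\<nu> - \<mu>) \<le> 1 \<and> piece_solution \<nu> U V \<and> i \<in> {1..k}
      \<and> x \<in> {knot (i - 1)..knot i} \<longrightarrow> d U V i x \<le> C * (d U V 1 (-1) + cmod (\<nu> - \<mu>))"
    if "1 \<le> k" "k \<le> 4" for k
    using that
  proof (induction k rule: nat_induct_at_least)
    case base
    from one[of 1] show ?case by (auto simp: knot_simps)
  next
    case (Suc k)
    then have k: "k \<in> {1..3}" "k \<in> {1..4}" "Suc k \<in> {1..4}" by auto
    obtain C where C: "C \<ge> 0" "\<And>\<nu> U V i x. cmod (\<nu> - \<mu>) \<le> 1 \<Longrightarrow> piece_solution \<nu> U V \<Longrightarrow> i \<in> {1..k} \<Longrightarrow>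
        x \<in> {knot (i - 1)..knot i} \<Longrightarrow> d U V i x \<le> C * (d U V 1 (-1) + cmod (\<nu> - \<mu>))"
      using Suc by auto
    from one[OF k(3)] obtain K where K: "K \<ge> 0" "\<And>\<nu> U V x. cmod (\<nu> - \<mu>) \<le> 1 \<Longrightarrow> piece_solution \<nu> U V \<Longrightarrow>
        x \<in> {knot k..knot (Suc k)} \<Longrightarrow> d U V (Suc k) x \<le> K * (d U V (Suc k) (knot k) + cmod (\<nu> - \<mu>))"
      by auto
    define M where "M = \<bar>\<alpha> (2*k + 1)\<bar> + \<bar>\<beta> (2*k + 1)\<bar> + \<bar>\<alpha> (2*k + 2)\<bar> + \<bar>\<beta> (2*k + 2)\<bar>"
    have M: "d U V (Suc k) (knot k) \<le> M * d U V k (knot k)" if U: "piece_solution \<nu> U V" for \<nu> U V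
    proof -
      define e f where "e = U k (knot k) - X k (knot k)" and "f = V k (knot k) - Y k (knot k)"
      have lin: "cmod (a *\<^sub>R e + b *\<^sub>R f) \<le> (\<bar>a\<bar> + \<bar>b\<bar>) * (cmod e + cmod f)" for a b
      proof -
        have "cmod (a *\<^sub>R e + b *\<^sub>R f) \<le> \<bar>a\<bar> * cmod e + \<bar>b\<bar> * cmod f"
          using norm_triangle_ineq[of "a *\<^sub>R e" "b *\<^sub>R f"] by simp
        also have "\<dots> \<le> (\<bar>a\<bar> + \<bar>b\<bar>) * (cmod e + cmod f)" by (simp add: algebra_simps)
        finally show ?thesis .
      qed
      have "d U V (Suc k) (knot k) = cmod (\<alpha> (2*k + 1) *\<^sub>R e + \<beta> (2*k + 1) *\<^sub>R f)
          + cmod (\<alpha> (2*k + 2) *\<^sub>R e + \<beta> (2*k + 2) *\<^sub>R f)"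
        using U X k(1) by (simp add: d_def piece_solution_def e_def f_def algebra_simps)
      also have "\<dots> \<le> M * (cmod e + cmod f)"
        using lin[of "\<alpha> (2*k + 1)" "\<beta> (2*k + 1)"] lin[of "\<alpha> (2*k + 2)" "\<beta> (2*k + 2)"]
        by (simp add: M_def algebra_simps)
      finally show ?thesis by (simp add: d_def e_def f_def)
    qed
    have "M \<ge> 0" by (simp add: M_def)
    show ?case
    proof (intro exI[of _ "C + K * (M * C + 1)"] conjI allI impI)
      show "0 \<le> C + K * (M * C + 1)" using C(1) K(1) \<open>M \<ge> 0\<close> by simp
      fix \<nu> U V i x
      assume A: "cmod (\<nu> - \<mu>) \<le> 1 \<and> piece_solution \<nu> U V \<and> i \<in> {1..Suc k} \<and> x \<in> {knot (i - 1)..knot i}"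
      define r where "r = d U V 1 (-1) + cmod (\<nu> - \<mu>)"
      have r: "r \<ge> 0" "cmod (\<nu> - \<mu>) \<le> r" using d0 by (auto simp: r_def)
      show "d U V i x \<le> (C + K * (M * C + 1)) * (d U V 1 (-1) + cmod (\<nu> - \<mu>))"
      proof (cases "i \<le> k")
        case True
        then have "d U V i x \<le> C * r" using C(2)[of \<nu> U V i x] A by (auto simp: r_def)
        also have "\<dots> \<le> (C + K * (M * C + 1)) * r"
          using C(1) K(1) \<open>M \<ge> 0\<close> r by (intro mult_right_mono) auto
        finally show ?thesis by (simp add: r_def)
      next
        case False
        then have i: "i = Suc k" using A by auto
        have "d U V k (knot k) \<le> C * r"
          using C(2)[of \<nu> U V k "knot k"] A k knot_less[OF k(2)] by (auto simp: r_def)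
        then have "d U V (Suc k) (knot k) \<le> M * (C * r)"
          using M[of \<nu> U V] A \<open>M \<ge> 0\<close> by (meson mult_left_mono order_trans)
        moreover have "d U V i x \<le> K * (d U V (Suc k) (knot k) + cmod (\<nu> - \<mu>))"
          using K(2)[of \<nu> U V x] A i by auto
        ultimately have "d U V i x \<le> K * (M * (C * r) + r)"
          using K(1) r by (meson add_mono mult_left_mono order_trans)
        also have "\<dots> = K * (M * C + 1) * r" by (simp add: algebra_simps)
        also have "\<dots> \<le> (C + K * (M * C + 1)) * r"
          using C(1) r by (intro mult_right_mono) auto
        finally show ?thesis by (simp add: r_def)
      qed
    qed
  qed
  from this[of 4] show ?thesis using that unfolding d_def by auto
qed

lemma piece_solution_unique:
  assumes U: "piece_solution \<nu> U V" and X: "piece_solution \<nu> X Y"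
    and init: "U 1 (-1) = X 1 (-1)" "V 1 (-1) = Y 1 (-1)"
    and i: "i \<in> {1..4}" and x: "x \<in> {knot (i - 1)..knot i}"
  shows "U i x = X i x" "V i x = Y i x"
proof -
  obtain C where "C \<ge> 0"
    "\<And>\<nu>' U V i x. \<lbrakk>cmod (\<nu>' - \<nu>) \<le> 1; piece_solution \<nu>' U V; i \<in> {1..4}; x \<in> {knot (i - 1)..knot i}\<rbrakk> \<Longrightarrow>
       cmod (U i x - X i x) + cmod (V i x - Y i x)
         \<le> C * (cmod (U 1 (-1) - X 1 (-1)) + cmod (V 1 (-1) - Y 1 (-1)) + cmod (\<nu>' - \<nu>))"
    using piece_solution_stability[OF X] by blast
  from this(2)[OF _ U i x] init have "cmod (U i x - X i x) + cmod (V i x - Y i x) \<le> 0" by simp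
  then show "U i x = X i x" "V i x = Y i x"
    using norm_ge_zero[of "U i x - X i x"] norm_ge_zero[of "V i x - Y i x"]
    by (simp_all add: add_nonneg_eq_0_iff order_antisym_conv)
qed

text \<open>
  Covers the two real-linear operations that are needed: multiplication by a complex constant, which
  keeps the parameter, and complex conjugation, which conjugates it.
\<close>
lemma piece_solution_bounded_linear:
  fixes L :: "complex \<Rightarrow> complex"
  assumes U: "piece_solution \<nu> U V" and L: "bounded_linear L"
    and mult: "\<And>r z. L ((of_real r - \<nu>) * z) = (of_real r - \<mu>) * L z"
  shows "piece_solution \<mu> (\<lambda>i x. L (U i x)) (\<lambda>i x. L (V i x))"
proof -
  have lin: "linear L" by (rule bounded_linear.linear[OF L])
  have "sl_solution a b P q \<mu> (\<lambda>x. L (u x)) (\<lambda>x. L (v x))" if "sl_solution a b P q \<nu> u v" for a b P u v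
  proof -
    obtain N where N: "negligible N" "\<And>x. x \<in> {a<..<b} - N \<Longrightarrow>
        (v has_vector_derivative (of_real (q x) - \<nu>) * u x / of_real P) (at x)"
      using \<open>sl_solution a b P q \<nu> u v\<close> by (auto simp: sl_solution_def)
    have "((\<lambda>x. L (v x)) has_vector_derivative (of_real (q x) - \<mu>) * L (u x) / of_real P) (at x)"
      if "x \<in> {a<..<b} - N" for x
    proof -
      have "L ((of_real (q x) - \<nu>) * u x / of_real P) = L (inverse P *\<^sub>R ((of_real (q x) - \<nu>) * u x))"
        by (simp add: scaleR_conv_of_real divide_inverse mult.commute)
      also have "\<dots> = (of_real (q x) - \<mu>) * L (u x) / of_real P"
        by (simp add: linear_scale[OF lin] mult) (simp add: scaleR_conv_of_real divide_inverse mult.commute)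
      finally show ?thesis using bounded_linear.has_vector_derivative[OF L N(2)[OF that]] by simp
    qed
    with N(1) that show ?thesis
      unfolding sl_solution_def
      by (auto intro!: bounded_linear.continuous_on[OF L] abs_continuous_on_bounded_linear[OF L]
            bounded_linear.has_vector_derivative[OF L])
  qed
  with U show ?thesis by (simp add: piece_solution_def linear_add[OF lin] linear_scale[OF lin])
qed

lemma piece_solution_scale:
  assumes "piece_solution \<nu> U V"
  shows "piece_solution \<nu> (\<lambda>i x. c * U i x) (\<lambda>i x. c * V i x)"
  by (rule piece_solution_bounded_linear[OF assms bounded_linear_mult_right]) simp

lemma piece_solution_cnj:
  assumes "piece_solution \<nu> U V"
  shows "piece_solution (cnj \<nu>) (\<lambda>i x. cnj (U i x)) (\<lambda>i x. cnj (V i x))"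
  by (rule piece_solution_bounded_linear[OF assms bounded_linear_cnj]) simp

text \<open>
  For initial data that do not depend on the parameter, the stability estimate reduces to a uniform
  bound by a multiple of \<open>\<bar>\<nu> - \<mu>\<bar>\<close>.
\<close>
lemma parameter_family_tendsto:
  assumes U: "\<And>\<nu>. piece_solution \<nu> (U \<nu>) (V \<nu>)"
    and init: "\<And>\<nu>. U \<nu> 1 (-1) = U \<mu> 1 (-1)" "\<And>\<nu>. V \<nu> 1 (-1) = V \<mu> 1 (-1)"
    and X: "\<And>i. i \<in> {1..4} \<Longrightarrow> continuous_on {knot (i - 1)..knot i} (X i)"
  shows "((\<lambda>\<nu>. pairing (U \<nu>) X) \<longlongrightarrow> pairing (U \<mu>) X) (at \<mu>)"
    and "((\<lambda>\<nu>. U \<nu> 4 1) \<longlongrightarrow> U \<mu> 4 1) (at \<mu>)" "((\<lambda>\<nu>. V \<nu> 4 1) \<longlongrightarrow> V \<mu> 4 1) (at \<mu>)"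
proof -
  obtain C where C: "C \<ge> 0"
    "\<And>\<nu> U' V' i x. \<lbrakk>cmod (\<nu> - \<mu>) \<le> 1; piece_solution \<nu> U' V'; i \<in> {1..4}; x \<in> {knot (i - 1)..knot i}\<rbrakk> \<Longrightarrow>
       cmod (U' i x - U \<mu> i x) + cmod (V' i x - V \<mu> i x)
         \<le> C * (cmod (U' 1 (-1) - U \<mu> 1 (-1)) + cmod (V' 1 (-1) - V \<mu> 1 (-1)) + cmod (\<nu> - \<mu>))"
    using piece_solution_stability[OF U] by blast
  have bd: "cmod (U \<nu> i x - U \<mu> i x) \<le> C * cmod (\<nu> - \<mu>)" "cmod (V \<nu> i x - V \<mu> i x) \<le> C * cmod (\<nu> - \<mu>)"
    if "cmod (\<nu> - \<mu>) \<le> 1" "i \<in> {1..4}" "x \<in> {knot (i - 1)..knot i}" for \<nu> i x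
  proof -
    have "cmod (U \<nu> i x - U \<mu> i x) + cmod (V \<nu> i x - V \<mu> i x) \<le> C * cmod (\<nu> - \<mu>)"
      using C(2)[OF that(1) U that(2,3)] unfolding init(1)[of \<nu>] init(2)[of \<nu>] by simp
    then show "cmod (U \<nu> i x - U \<mu> i x) \<le> C * cmod (\<nu> - \<mu>)" "cmod (V \<nu> i x - V \<mu> i x) \<le> C * cmod (\<nu> - \<mu>)"
      using norm_ge_zero[of "U \<nu> i x - U \<mu> i x"] norm_ge_zero[of "V \<nu> i x - V \<mu> i x"] by linarith+
  qed
  have near: "\<forall>\<^sub>F \<nu> in at \<mu>. cmod (\<nu> - \<mu>) \<le> 1"
    by (rule eventually_at_ball'[of 1 \<mu> UNIV, THEN eventually_mono]) (auto simp: dist_norm norm_minus_commute)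
  have lim0: "((\<lambda>\<nu>. K * cmod (\<nu> - \<mu>)) \<longlongrightarrow> 0) (at \<mu>)" for K
    by (auto intro!: tendsto_eq_intros)
  have 4: "(4::nat) \<in> {1..4}" "1 \<in> {knot (4 - 1)..knot 4}" using h by (auto simp: knot_simps)
  show "((\<lambda>\<nu>. U \<nu> 4 1) \<longlongrightarrow> U \<mu> 4 1) (at \<mu>)"
    by (rule LIM_zero_cancel, rule Lim_null_comparison[OF _ lim0[of C]])
       (rule eventually_mono[OF near], rule bd(1)[OF _ 4])
  show "((\<lambda>\<nu>. V \<nu> 4 1) \<longlongrightarrow> V \<mu> 4 1) (at \<mu>)"
    by (rule LIM_zero_cancel, rule Lim_null_comparison[OF _ lim0[of C]])
       (rule eventually_mono[OF near], rule bd(2)[OF _ 4])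
  have "((\<lambda>\<nu>. integral {knot (i - 1)..knot i} (\<lambda>t. U \<nu> i t * X i t)) \<longlongrightarrow>
      integral {knot (i - 1)..knot i} (\<lambda>t. U \<mu> i t * X i t)) (at \<mu>)" if i: "i \<in> {1..4}" for i
  proof -
    let ?J = "{knot (i - 1)..knot i}"
    obtain B where B: "B \<ge> 0" "\<And>x. x \<in> ?J \<Longrightarrow> norm (X i x) \<le> B"
      using bounded_on_interval[OF X[OF i]] by blast
    have c: "continuous_on ?J (U \<nu> i)" for \<nu> using piece_solution_continuous[OF U i] .
    have int: "(\<lambda>t. U \<nu> i t * X i t) integrable_on ?J" for \<nu>
      by (intro integrable_continuous_interval continuous_intros c X i)
    have "\<forall>\<^sub>F \<nu> in at \<mu>. norm (integral ?J (\<lambda>t. U \<nu> i t * X i t) - integral ?J (\<lambda>t. U \<mu> i t * X i t))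
        \<le> (C * B * (knot i - knot (i - 1))) * cmod (\<nu> - \<mu>)"
      using near
    proof eventually_elim
      case (elim \<nu>)
      have "integral ?J (\<lambda>t. U \<nu> i t * X i t) - integral ?J (\<lambda>t. U \<mu> i t * X i t)
          = integral ?J (\<lambda>t. (U \<nu> i t - U \<mu> i t) * X i t)"
        using Henstock_Kurzweil_Integration.integral_diff[OF int int] by (simp add: algebra_simps)
      also have "norm \<dots> \<le> (C * cmod (\<nu> - \<mu>) * B) * (knot i - knot (i - 1))"
      proof (rule integral_bound)
        show "knot (i - 1) \<le> knot i" using knot_less[OF i] by simp
        show "continuous_on ?J (\<lambda>t. (U \<nu> i t - U \<mu> i t) * X i t)" by (intro continuous_intros c X i)
        show "norm ((U \<nu> i t - U \<mu> i t) * X i t) \<le> C * cmod (\<nu> - \<mu>) * B" if "t \<in> ?J" for t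
          unfolding norm_mult using bd(1)[OF elim i that] B that C(1) by (intro mult_mono) auto
      qed
      finally show ?case by (simp add: mult_ac)
    qed
    from LIM_zero_cancel[OF Lim_null_comparison[OF this lim0]] show ?thesis .
  qed
  then show "((\<lambda>\<nu>. pairing (U \<nu>) X) \<longlongrightarrow> pairing (U \<mu>) X) (at \<mu>)"
    unfolding pairing_def by (intro tendsto_sum tendsto_mult tendsto_const) blast
qed

end

section \<open>The characteristic function and its derivative\<close>

text \<open>
  Here \<open>\<phi>\<close>, \<open>\<psi>\<close> are the piecewise forms of the two normalised solutions and \<open>\<phi>'\<close>, \<open>\<psi>'\<close> those of their
  derivatives.
\<close>
locale characteristic_problem = transmission_problem +
  fixes \<beta>' :: "nat \<Rightarrow> real"
    and \<phi> \<phi>' \<psi> \<psi>' :: "complex \<Rightarrow> nat \<Rightarrow> real \<Rightarrow> complex"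
    and w :: "complex \<Rightarrow> complex"
  assumes \<rho>: "\<beta>' 1 * \<beta> 2 - \<beta> 1 * \<beta>' 2 > 0"
    and \<alpha>: "\<bar>\<alpha> 1\<bar> + \<bar>\<alpha> 2\<bar> \<noteq> 0"
    and \<phi>: "\<And>\<nu>. piece_solution \<nu> (\<phi> \<nu>) (\<phi>' \<nu>)"
    and \<phi>_init: "\<And>\<nu>. \<phi> \<nu> 1 (-1) = \<alpha> 2" "\<And>\<nu>. \<phi>' \<nu> 1 (-1) = - \<alpha> 1"
    and \<psi>: "\<And>\<nu>. piece_solution \<nu> (\<psi> \<nu>) (\<psi>' \<nu>)"
    and \<psi>_end: "\<And>\<nu>. \<psi> \<nu> 4 1 = \<nu> * \<beta>' 2 + \<beta> 2" "\<And>\<nu>. \<psi>' \<nu> 4 1 = \<nu> * \<beta>' 1 + \<beta> 1"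
    and w: "\<And>\<nu>. w \<nu> = piece_wronskian (\<phi> \<nu>) (\<phi>' \<nu>) (\<psi> \<nu>) (\<psi>' \<nu>) 1 (-1)"
begin

text \<open>
  The coefficient of the eigenparameter in the boundary condition at \<open>1\<close>, evaluated on \<open>\<phi>\<close>. It is the
  extra scalar component of an eigenfunction in the self-adjoint formulation of the problem.
\<close>
definition boundary_form :: "complex \<Rightarrow> complex" where
  "boundary_form \<nu> = \<beta>' 1 * \<phi> \<nu> 4 1 - \<beta>' 2 * \<phi>' \<nu> 4 1"

lemma w_right_endpoint:
  fixes \<nu> :: complex
  shows "weight 1 * w \<nu> = (\<nu> * \<beta>' 1 + \<beta> 1) * \<phi> \<nu> 4 1 - (\<nu> * \<beta>' 2 + \<beta> 2) * \<phi>' \<nu> 4 1"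
proof -
  have "piece_wronskian (\<phi> \<nu>) (\<phi>' \<nu>) (\<psi> \<nu>) (\<psi>' \<nu>) 4 1 = weight 1 * w \<nu>"
    using lagrange_identity_pieces[OF \<phi>[of \<nu>] \<psi>[of \<nu>]] w[of \<nu>] by simp
  then show ?thesis by (simp add: piece_wronskian_def \<psi>_end algebra_simps)
qed

text \<open>
  The Wronskian of \<open>\<phi>(\<cdot>,\<nu>)\<close> and \<open>\<psi>(\<cdot>,\<mu>)\<close> at \<open>-1\<close> is \<open>w \<mu>\<close>, as the initial data of \<open>\<phi>\<close> are the same for
  all parameters. At \<open>1\<close>, replacing the data of \<open>\<psi>(\<cdot>,\<nu>)\<close> by those of \<open>\<psi>(\<cdot>,\<mu>)\<close> changes the
  Wronskian by \<open>(\<nu> - \<mu>) boundary_form \<nu>\<close>.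
\<close>
lemma w_difference:
  fixes \<nu> \<mu> :: complex
  shows "weight 1 * (w \<nu> - w \<mu>) = (\<nu> - \<mu>) * (pairing (\<phi> \<nu>) (\<psi> \<mu>) + boundary_form \<nu>)"
proof -
  have left: "piece_wronskian (\<phi> \<nu>) (\<phi>' \<nu>) (\<psi> \<mu>) (\<psi>' \<mu>) 1 (-1) = w \<mu>"
    unfolding w piece_wronskian_def by (simp only: \<phi>_init)
  have right: "piece_wronskian (\<phi> \<nu>) (\<phi>' \<nu>) (\<psi> \<mu>) (\<psi>' \<mu>) 4 1 = weight 1 * w \<nu> - (\<nu> - \<mu>) * boundary_form \<nu>"
    unfolding w_right_endpoint boundary_form_def by (simp add: piece_wronskian_def \<psi>_end algebra_simps)
  show ?thesis
    using lagrange_identity_pieces[OF \<phi>[of \<nu>] \<psi>[of \<mu>]] unfolding left right by algebra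
qed

lemma w_derivative:
  "(w has_field_derivative (pairing (\<phi> \<mu>) (\<psi> \<mu>) + boundary_form \<mu>) / weight 1) (at \<mu>)"
proof -
  have init: "\<phi> \<nu> 1 (-1) = \<phi> \<mu> 1 (-1)" "\<phi>' \<nu> 1 (-1) = \<phi>' \<mu> 1 (-1)" for \<nu>
    unfolding \<phi>_init by simp_all
  note lim = parameter_family_tendsto[where U = \<phi> and V = \<phi>' and X = "\<psi> \<mu>", OF \<phi> init
      piece_solution_continuous[OF \<psi>]]
  have "((\<lambda>\<nu>. (pairing (\<phi> \<nu>) (\<psi> \<mu>) + boundary_form \<nu>) / weight 1) \<longlongrightarrow>
      (pairing (\<phi> \<mu>) (\<psi> \<mu>) + boundary_form \<mu>) / weight 1) (at \<mu>)"
    unfolding boundary_form_def using weight_pos[of 1] by (intro tendsto_intros lim) simp_all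
  moreover have "\<forall>\<^sub>F \<nu> in at \<mu>. (pairing (\<phi> \<nu>) (\<psi> \<mu>) + boundary_form \<nu>) / weight 1 = (w \<nu> - w \<mu>) / (\<nu> - \<mu>)"
  proof -
    have "(pairing (\<phi> \<nu>) (\<psi> \<mu>) + boundary_form \<nu>) / weight 1 = (w \<nu> - w \<mu>) / (\<nu> - \<mu>)" if "\<nu> \<noteq> \<mu>" for \<nu>
      using w_difference[of \<nu> \<mu>] that weight_pos[of 1] by (simp add: field_simps)
    then show ?thesis by (simp add: eventually_at_filter)
  qed
  ultimately show ?thesis
    unfolding has_field_derivative_iff by (rule Lim_transform_eventually)
qed

text \<open>
  If \<open>\<phi>(\<cdot>,\<mu>)\<close> satisfies the boundary condition at \<open>1\<close>, it is proportional to \<open>\<psi>(\<cdot>,\<mu>)\<close>, and \<open>\<mu>\<close> and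
  \<open>\<phi>(\<cdot>,\<mu>)\<close> are real by self-adjointness. The sum in the second conclusion is then, up to the nonzero
  real factor \<open>1 / boundary_form \<mu>\<close>, a nonnegative number plus \<open>(boundary_form \<mu>)\<^sup>2\<close>. Both the reality
  of \<open>\<mu>\<close> and the final inequality use this same positive quantity.
\<close>
lemma simple_zero:
  assumes bc: "\<mu> * boundary_form \<mu> + (\<beta> 1 * \<phi> \<mu> 4 1 - \<beta> 2 * \<phi>' \<mu> 4 1) = 0"
  shows "w \<mu> = 0" and "pairing (\<phi> \<mu>) (\<psi> \<mu>) + boundary_form \<mu> \<noteq> 0"
proof -
  define \<rho> where "\<rho> = \<beta>' 1 * \<beta> 2 - \<beta> 1 * \<beta>' 2"
  have \<rho>_pos: "\<rho> > 0" using \<rho> by (simp add: \<rho>_def)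
  have R1: "\<beta> 1 * \<phi> \<mu> 4 1 - \<beta> 2 * \<phi>' \<mu> 4 1 = - \<mu> * boundary_form \<mu>"
    using bc by (simp add: eq_neg_iff_add_eq_0 add.commute)
  have "weight 1 * w \<mu> = 0"
    using bc w_right_endpoint[of \<mu>] by (simp add: boundary_form_def algebra_simps)
  then show w0: "w \<mu> = 0" using weight_pos[of 1] by simp
  have "\<alpha> 1 * \<psi> \<mu> 1 (-1) + \<alpha> 2 * \<psi>' \<mu> 1 (-1) = 0"
    using w0 unfolding w piece_wronskian_def by (simp add: \<phi>_init[simplified] algebra_simps)
  then obtain k :: complex where k: "\<psi> \<mu> 1 (-1) = k * \<alpha> 2" "\<psi>' \<mu> 1 (-1) = k * (- \<alpha> 1)"
    using proportional_initial_data[OF \<alpha>] by metis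
  have multiple: "\<psi> \<mu> i x = k * \<phi> \<mu> i x" "\<psi>' \<mu> i x = k * \<phi>' \<mu> i x"
    if "i \<in> {1..4}" "x \<in> {knot (i - 1)..knot i}" for i x
    using piece_solution_unique[OF \<psi>[of \<mu>] piece_solution_scale[OF \<phi>[of \<mu>], of k] _ _ that] k \<phi>_init
    by simp_all
  have e4: "(4::nat) \<in> {1..4}" "1 \<in> {knot (4 - 1)..knot 4}" using h by (auto simp: knot_simps)
  have kR: "k * boundary_form \<mu> = \<rho>"
  proof -
    have "k * boundary_form \<mu> = \<beta>' 1 * \<psi> \<mu> 4 1 - \<beta>' 2 * \<psi>' \<mu> 4 1"
      unfolding multiple[OF e4] boundary_form_def by (simp add: algebra_simps)
    then show ?thesis unfolding \<psi>_end by (simp add: \<rho>_def algebra_simps)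
  qed
  then have R0: "boundary_form \<mu> \<noteq> 0" using \<rho>_pos by auto
  obtain r where r: "r \<ge> 0" "pairing (\<phi> \<mu>) (\<lambda>i x. cnj (\<phi> \<mu> i x)) = complex_of_real r"
    using pairing_cnj_nonneg[OF \<phi>] by blast
  have "cnj \<mu> = \<mu>"
  proof -
    let ?u = "\<phi> \<mu> 4 1" and ?v = "\<phi>' \<mu> 4 1"
    have "?u * cnj ?v - ?v * cnj ?u = (\<mu> - cnj \<mu>) * r"
      using lagrange_identity_pieces[OF \<phi>[of \<mu>] piece_solution_cnj[OF \<phi>[of \<mu>]]] r
      by (simp add: piece_wronskian_def \<phi>_init[simplified])
    \<comment> \<open>By Lagrange's identity this Wronskian is a nonnegative multiple of \<open>\<mu> - cnj \<mu>\<close>,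
      and by the boundary condition at \<open>1\<close> it is a negative one.\<close>
    moreover have "- \<rho> * (?u * cnj ?v - ?v * cnj ?u)
        = boundary_form \<mu> * cnj (\<beta> 1 * ?u - \<beta> 2 * ?v) - (\<beta> 1 * ?u - \<beta> 2 * ?v) * cnj (boundary_form \<mu>)"
      unfolding boundary_form_def \<rho>_def by (simp add: algebra_simps)
    moreover have "\<dots> = (\<mu> - cnj \<mu>) * complex_of_real ((cmod (boundary_form \<mu>))\<^sup>2)"
      unfolding R1 complex_norm_square by (simp add: algebra_simps)
    ultimately have "(\<mu> - cnj \<mu>) * complex_of_real (\<rho> * r + (cmod (boundary_form \<mu>))\<^sup>2) = 0"
      unfolding of_real_add of_real_mult of_real_minus by algebra
    moreover have "\<rho> * r + (cmod (boundary_form \<mu>))\<^sup>2 > 0"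
      using r(1) R0 \<rho>_pos by (intro add_nonneg_pos) auto
    ultimately show ?thesis by (simp del: of_real_add of_real_mult)
  qed
  then have real: "cnj (\<phi> \<mu> i x) = \<phi> \<mu> i x" "cnj (\<phi>' \<mu> i x) = \<phi>' \<mu> i x"
    if "i \<in> {1..4}" "x \<in> {knot (i - 1)..knot i}" for i x
    using piece_solution_unique[OF piece_solution_cnj[OF \<phi>[of \<mu>], unfolded \<open>cnj \<mu> = \<mu>\<close>] \<phi>[of \<mu>] _ _ that]
      \<phi>_init by simp_all
  have "cnj (boundary_form \<mu>) = boundary_form \<mu>" using real[OF e4] by (simp add: boundary_form_def)
  then have "boundary_form \<mu> * boundary_form \<mu> = complex_of_real ((cmod (boundary_form \<mu>))\<^sup>2)" using complex_norm_square[of "boundary_form \<mu>"] by simp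
  moreover have "pairing (\<phi> \<mu>) (\<psi> \<mu>) = k * r"
  proof -
    have "pairing (\<phi> \<mu>) (\<psi> \<mu>) = pairing (\<phi> \<mu>) (\<lambda>i x. k * cnj (\<phi> \<mu> i x))"
      by (rule pairing_cong) (simp add: multiple real)
    then show ?thesis using r by (simp add: pairing_scale)
  qed
  ultimately have "boundary_form \<mu> * (pairing (\<phi> \<mu>) (\<psi> \<mu>) + boundary_form \<mu>) = complex_of_real (\<rho> * r + (cmod (boundary_form \<mu>))\<^sup>2)"
    using kR by (simp add: algebra_simps)
  moreover have "\<rho> * r + (cmod (boundary_form \<mu>))\<^sup>2 > 0"
    using r(1) R0 \<rho>_pos by (intro add_nonneg_pos) auto
  ultimately show "pairing (\<phi> \<mu>) (\<psi> \<mu>) + boundary_form \<mu> \<noteq> 0"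
    by (metis less_irrefl mult_zero_right of_real_eq_0_iff)
qed

text \<open>
  By uniqueness an eigenfunction is a multiple of \<open>\<phi>(\<cdot>,\<mu>)\<close>, and the factor is nonzero because the
  eigenfunction is nontrivial. So \<open>\<phi>(\<cdot>,\<mu>)\<close> inherits the boundary condition at \<open>1\<close>.
\<close>
lemma eigenvalue_condition:
  assumes "is_eigenvalue h p q \<alpha> \<beta> \<beta>' \<mu>"
  shows "\<mu> * boundary_form \<mu> + (\<beta> 1 * \<phi> \<mu> 4 1 - \<beta> 2 * \<phi>' \<mu> 4 1) = 0"
proof -
  obtain u y where u: "solves_problem h p q \<alpha> \<beta> \<beta>' \<mu> u" and y: "y \<in> dom_I h" "u y \<noteq> 0"
    using assms by (auto simp: is_eigenvalue_def)
  define U V where "U = pieces u" and "V = pieces (D_I h u)"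
  have sol: "piece_solution \<mu> U V" and ends: "U 1 (-1) = u (-1)" "V 1 (-1) = D_I h u (-1)"
    "U 4 1 = u 1" "V 4 1 = D_I h u 1"
    using piece_solution_pieces[of \<mu> u] u by (auto simp: solves_problem_def U_def V_def)
  have bc: "\<alpha> 1 * U 1 (-1) + \<alpha> 2 * V 1 (-1) = 0"
    "\<mu> * (\<beta>' 1 * U 4 1 - \<beta>' 2 * V 4 1) + (\<beta> 1 * U 4 1 - \<beta> 2 * V 4 1) = 0"
    using u unfolding ends by (simp_all add: solves_problem_def scaleR_conv_of_real)
  obtain s :: complex where s: "U 1 (-1) = s * \<alpha> 2" "V 1 (-1) = s * (- \<alpha> 1)"
    using proportional_initial_data[OF \<alpha> bc(1)] by metis
  have multiple: "U i x = s * \<phi> \<mu> i x" "V i x = s * \<phi>' \<mu> i x"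
    if "i \<in> {1..4}" "x \<in> {knot (i - 1)..knot i}" for i x
    using piece_solution_unique[OF sol piece_solution_scale[OF \<phi>[of \<mu>], of s] _ _ that] s \<phi>_init
    by simp_all
  have e4: "(4::nat) \<in> {1..4}" "1 \<in> {knot (4 - 1)..knot 4}" using h by (auto simp: knot_simps)
  have "s \<noteq> 0"
  proof
    assume "s = 0"
    from y(1) have "u y = 0"
    proof (cases rule: dom_I_cases)
      case 1 then show ?thesis using ends(1) s(1) \<open>s = 0\<close> by simp
    next
      case 2 then show ?thesis using ends(3) multiple(1)[OF e4] \<open>s = 0\<close> by simp
    next
      case (3 i)
      then have "U i y = 0" using multiple(1)[of i y] \<open>s = 0\<close> by simp
      then show ?thesis using 3 by (simp add: U_def pieces_inside)
    qed
    with y(2) show False by simp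
  qed
  have "s * (\<mu> * boundary_form \<mu> + (\<beta> 1 * \<phi> \<mu> 4 1 - \<beta> 2 * \<phi>' \<mu> 4 1)) = 0"
    using bc(2) unfolding multiple[OF e4] boundary_form_def by (simp add: algebra_simps)
  with \<open>s \<noteq> 0\<close> show ?thesis by simp
qed

theorem eigenvalue_simple_zero:
  assumes "is_eigenvalue h p q \<alpha> \<beta> \<beta>' \<mu>"
  shows "w holomorphic_on UNIV \<and> w \<mu> = 0 \<and> isolated_zero w \<mu> \<and> zorder w \<mu> = 1"
proof -
  note zero = simple_zero[OF eigenvalue_condition[OF assms]]
  have hol: "w holomorphic_on UNIV"
    using w_derivative by (auto simp: holomorphic_on_def field_differentiable_def)
  have d: "deriv w \<mu> \<noteq> 0"
    using DERIV_imp_deriv[OF w_derivative[of \<mu>]] zero(2) weight_pos[of 1] by simp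
  have "isolated_zero w \<mu>"
  proof (rule ccontr)
    assume "\<not> isolated_zero w \<mu>"
    moreover have "w analytic_on {\<mu>}" using hol by (simp add: analytic_on_holomorphic) blast
    ultimately have "eventually (\<lambda>z. w z = 0) (nhds \<mu>)"
      using zero(1) non_isolated_zero_imp_eventually_zero' by blast
    then have "deriv w \<mu> = deriv (\<lambda>_. 0) \<mu>" by (intro deriv_cong_ev) auto
    with d show False by simp
  qed
  moreover have "zorder w \<mu> = 1"
    by (rule zorder_zero_eqI[OF hol]) (use zero(1) d in auto)
  ultimately show ?thesis using hol zero(1) by blast
qed

end

theorem theorem2p1:
  fixes h p \<alpha> \<beta> \<beta>' :: "nat \<Rightarrow> real"
    and q :: "real \<Rightarrow> real"
    and \<phi> \<psi> :: "complex \<Rightarrow> real \<Rightarrow> complex"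
    and w :: "complex \<Rightarrow> complex"
    and x\<^sub>0 :: real
    and \<mu> :: complex
  assumes "-1 < h 1" and "h 1 < h 2" and "h 2 < h 3" and "h 3 < 1"
    and "p 1 \<noteq> 0" and "p 2 \<noteq> 0" and "p 3 \<noteq> 0" and "p 4 \<noteq> 0"
    and "q absolutely_integrable_on dom_I h"
    and "\<alpha> 3 * \<beta> 4 - \<beta> 3 * \<alpha> 4 > 0"
    and "\<alpha> 5 * \<beta> 6 - \<beta> 5 * \<alpha> 6 > 0"
    and "\<alpha> 7 * \<beta> 8 - \<beta> 7 * \<alpha> 8 > 0"
    and "\<beta>' 1 * \<beta> 2 - \<beta> 1 * \<beta>' 2 > 0"
    and "\<bar>\<alpha> 1\<bar> + \<bar>\<alpha> 2\<bar> \<noteq> 0"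
    and "\<And>\<nu>. is_phi h p q \<alpha> \<beta> \<nu> (\<phi> \<nu>)"
    and "\<And>\<nu>. is_chi h p q \<alpha> \<beta> \<beta>' \<nu> (\<psi> \<nu>)"
    and "x\<^sub>0 \<in> {-1..<h 1}"
    and "\<And>\<nu>. w \<nu> = wronskian h (\<phi> \<nu>) (\<psi> \<nu>) x\<^sub>0"
    and "is_eigenvalue h p q \<alpha> \<beta> \<beta>' \<mu>"
  shows "w holomorphic_on UNIV \<and> w \<mu> = 0 \<and> isolated_zero w \<mu> \<and> zorder w \<mu> = 1"
proof -
  interpret transmission_problem h p \<alpha> \<beta> q
    by unfold_locales (rule assms)+
  have sol_\<phi>: "solves_equation h p q \<nu> (\<phi> \<nu>)" "transmission h \<alpha> \<beta> (\<phi> \<nu>)"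
    "\<phi> \<nu> (-1) = \<alpha> 2" "D_I h (\<phi> \<nu>) (-1) = - \<alpha> 1" for \<nu>
    using assms(15)[of \<nu>] by (auto simp: is_phi_def)
  have sol_\<psi>: "solves_equation h p q \<nu> (\<psi> \<nu>)" "transmission h \<alpha> \<beta> (\<psi> \<nu>)"
    "\<psi> \<nu> 1 = \<nu> * \<beta>' 2 + \<beta> 2" "D_I h (\<psi> \<nu>) 1 = \<nu> * \<beta>' 1 + \<beta> 1" for \<nu>
    using assms(16)[of \<nu>] by (auto simp: is_chi_def)
  note P\<phi> = piece_solution_pieces[OF sol_\<phi>(1,2)] and P\<psi> = piece_solution_pieces[OF sol_\<psi>(1,2)]
  have first: "pieces f 1 x\<^sub>0 = f x\<^sub>0" if "pieces f 1 (-1) = f (-1)" for f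
    using that assms(17) pieces_inside[of x\<^sub>0 1 f] by (cases "x\<^sub>0 = -1") (auto simp: knot_simps)
  have "w \<nu> = piece_wronskian (pieces (\<phi> \<nu>)) (pieces (D_I h (\<phi> \<nu>))) (pieces (\<psi> \<nu>)) (pieces (D_I h (\<psi> \<nu>))) 1 (-1)" for \<nu>
  proof -
    have "w \<nu> = piece_wronskian (pieces (\<phi> \<nu>)) (pieces (D_I h (\<phi> \<nu>))) (pieces (\<psi> \<nu>)) (pieces (D_I h (\<psi> \<nu>))) 1 x\<^sub>0"
      unfolding assms(18) wronskian_def piece_wronskian_def first[OF P\<phi>(2)] first[OF P\<phi>(3)] first[OF P\<psi>(2)]
        first[OF P\<psi>(3)] ..
    also have "\<dots> = piece_wronskian (pieces (\<phi> \<nu>)) (pieces (D_I h (\<phi> \<nu>))) (pieces (\<psi> \<nu>)) (pieces (D_I h (\<psi> \<nu>))) 1 (-1)"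
      using assms(17) by (intro piece_wronskian_constant_first_piece[OF P\<phi>(1) P\<psi>(1)]) auto
    finally show ?thesis .
  qed
  then interpret characteristic_problem h p \<alpha> \<beta> q \<beta>' "\<lambda>\<nu>. pieces (\<phi> \<nu>)" "\<lambda>\<nu>. pieces (D_I h (\<phi> \<nu>))"
      "\<lambda>\<nu>. pieces (\<psi> \<nu>)" "\<lambda>\<nu>. pieces (D_I h (\<psi> \<nu>))" w
    by unfold_locales (use assms(13,14) P\<phi> P\<psi> sol_\<phi>(3,4) sol_\<psi>(3,4) in simp_all)
  show ?thesis by (rule eigenvalue_simple_zero[OF assms(19)])
qed
end
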